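(* Let $K$ be a field, let $t\ge 1$ be an integer, let $X$ be a $(2t+1)\times(2t+1)$ skew-symmetric matrix of indeterminates over $K$, let $R=K[X]$, and let $M_t\subset R$ be the ideal generated by the $2t$-pfaffians of $X$. Then a minimal graded free resolution of $M_t$ over $R$ has the form $$0\longrightarrow R(-2t-1)\longrightarrow R(-t-1)^{2t+1}\longrightarrow R(-t)^{2t+1}\longrightarrow M_t\longrightarrow 0.$$
   Context: A skew-symmetric matrix of indeterminates $X=(x_{ij})$ has entries $x_{ij}$, $i<j$, that are independent indeterminates over $K$, with $x_{ji}=-x_{ij}$ and $x_{ii}=0$; $R=K[X]=K[x_{ij}\mid i<j]$ is standard graded. A $2t$-pfaffian is the pfaffian of the submatrix of $X$ with rows and columns indexed by the same set of $2t$ indices. $R(-a)$ denotes the graded free module of rank one with generator in degree $a$. *)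

theory Defs
  imports
    "HOL-Algebra.Ideal"
    "HOL-Algebra.Module"
    "HOL-Combinatorics.Permutations"
    "HOL-Library.Poly_Mapping"
    "Jordan_Normal_Form.DL_Submatrix"
begin

section \<open>Graded rings, graded modules and minimal graded free resolutions\<close>

record 'a graded_ring = "'a ring" +
  ring_part :: "int \<Rightarrow> 'a set"

record ('a, 'b) graded_module = "('a, 'b) module" +
  module_part :: "int \<Rightarrow> 'b set"

text \<open>\<open>A\<close> is the internal direct sum of the family \<open>P\<close> of additive subgroups.\<close>

definition internal_direct_sum :: "('b, 'c) ring_scheme \<Rightarrow> (int \<Rightarrow> 'b set) \<Rightarrow> bool" where
  "internal_direct_sum A P \<longleftrightarrow>
     (\<forall>n. additive_subgroup (P n) A) \<and>
     (\<forall>x \<in> carrier A. \<exists>!c. (\<forall>n. c n \<in> P n) \<and> finite {n. c n \<noteq> \<zero>\<^bsub>A\<^esub>} \<and>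
        x = finsum A c {n. c n \<noteq> \<zero>\<^bsub>A\<^esub>})"

locale graded_ring = cring R for R :: "'a graded_ring" (structure) +
  assumes ring_direct_sum: "internal_direct_sum R (ring_part R)"
    and part_mult: "\<lbrakk>a \<in> ring_part R m; b \<in> ring_part R n\<rbrakk> \<Longrightarrow> a \<otimes> b \<in> ring_part R (m + n)"

locale graded_module = R?: graded_ring R + M?: Module.module R M
  for R :: "'a graded_ring" (structure) and M :: "('a, 'b) graded_module" (structure) +
  assumes module_direct_sum: "internal_direct_sum M (module_part M)"
    and part_smult: "\<lbrakk>a \<in> ring_part R m; x \<in> module_part M n\<rbrakk> \<Longrightarrow> a \<odot>\<^bsub>M\<^esub> x \<in> module_part M (m + n)"

text \<open>Homomorphisms of graded modules are \<open>R\<close>-linear and preserve degrees.\<close>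

definition graded_hom ::
    "'a graded_ring \<Rightarrow> ('a, 'b) graded_module \<Rightarrow> ('a, 'c) graded_module \<Rightarrow> ('b \<Rightarrow> 'c) set" where
  "graded_hom R M N = {f \<in> hom (add_monoid M) (add_monoid N).
     (\<forall>a \<in> carrier R. \<forall>x \<in> carrier M. f (a \<odot>\<^bsub>M\<^esub> x) = a \<odot>\<^bsub>N\<^esub> f x) \<and>
     (\<forall>n. f ` module_part M n \<subseteq> module_part N n)}"

text \<open>
  \<open>graded_free R [a\<^sub>0, \<dots>, a\<^sub>k\<^sub>-\<^sub>1]\<close> is \<open>R(-a\<^sub>0) \<oplus> \<dots> \<oplus> R(-a\<^sub>k\<^sub>-\<^sub>1)\<close>, so the \<open>i\<close>-th basis element has degree
  \<open>a\<^sub>i\<close>. Its elements are the \<open>k\<close>-tuples over \<open>R\<close>, as extensional functions on \<open>{..<k}\<close>. The ring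
  multiplication fields of a module record are irrelevant.
\<close>

definition graded_free :: "'a graded_ring \<Rightarrow> int list \<Rightarrow> ('a, nat \<Rightarrow> 'a) graded_module" where
  "graded_free R as =
    \<lparr>carrier = {..<length as} \<rightarrow>\<^sub>E carrier R,
     monoid.mult = undefined,
     monoid.one = undefined,
     ring.zero = (\<lambda>i\<in>{..<length as}. \<zero>\<^bsub>R\<^esub>),
     ring.add = (\<lambda>u v. \<lambda>i\<in>{..<length as}. u i \<oplus>\<^bsub>R\<^esub> v i),
     smult = (\<lambda>c u. \<lambda>i\<in>{..<length as}. c \<otimes>\<^bsub>R\<^esub> u i),
     module_part = (\<lambda>n. \<Pi>\<^sub>E i\<in>{..<length as}. ring_part R (n - as ! i))\<rparr>"

definition ideal_module :: "'a graded_ring \<Rightarrow> 'a set \<Rightarrow> ('a, 'a) graded_module" where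
  "ideal_module R I =
    \<lparr>carrier = I, monoid.mult = undefined, monoid.one = undefined,
     ring.zero = \<zero>\<^bsub>R\<^esub>, ring.add = (\<oplus>\<^bsub>R\<^esub>),
     smult = (\<otimes>\<^bsub>R\<^esub>), module_part = (\<lambda>n. I \<inter> ring_part R n)\<rparr>"

definition irrelevant_ideal :: "'a graded_ring \<Rightarrow> 'a set" where
  "irrelevant_ideal R = genideal R (\<Union>n\<in>{0<..}. ring_part R n)"

text \<open>\<open>ideal_times R I M\<close> is the submodule \<open>I M\<close> of \<open>M\<close>.\<close>

definition ideal_times :: "'a graded_ring \<Rightarrow> 'a set \<Rightarrow> ('a, 'b) graded_module \<Rightarrow> 'b set" where
  "ideal_times R I M =
     \<Inter>{N. submodule N R M \<and> (\<forall>a\<in>I. \<forall>x\<in>carrier M. a \<odot>\<^bsub>M\<^esub> x \<in> N)}"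

text \<open>
  For a list \<open>S = [s\<^sub>0, \<dots>, s\<^sub>k]\<close> of lists of degrees, \<open>free_term R S i\<close> is the \<open>i\<close>-th free module of a
  resolution, which is zero for \<open>i > k\<close>.
\<close>

definition free_term :: "'a graded_ring \<Rightarrow> int list list \<Rightarrow> nat \<Rightarrow> ('a, nat \<Rightarrow> 'a) graded_module" where
  "free_term R S i = graded_free R (if i < length S then S ! i else [])"

text \<open>
  The complex \<open>\<dots> \<rightarrow> F\<^sub>2 \<rightarrow> F\<^sub>1 \<rightarrow> F\<^sub>0 \<rightarrow> M \<rightarrow> 0\<close> with \<open>F\<^sub>i = free_term R S i\<close>, differentials
  \<open>d i : F\<^sub>i\<^sub>+\<^sub>1 \<rightarrow> F\<^sub>i\<close> and augmentation \<open>e : F\<^sub>0 \<rightarrow> M\<close>. Since \<open>F\<^sub>i = 0\<close> for \<open>i \<ge> length S\<close>, exactness includes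
  injectivity of the leftmost map.
\<close>

definition graded_free_resolution ::
    "'a graded_ring \<Rightarrow> ('a, 'b) graded_module \<Rightarrow> int list list \<Rightarrow>
     (nat \<Rightarrow> (nat \<Rightarrow> 'a) \<Rightarrow> (nat \<Rightarrow> 'a)) \<Rightarrow> ((nat \<Rightarrow> 'a) \<Rightarrow> 'b) \<Rightarrow> bool" where
  "graded_free_resolution R M S d e \<longleftrightarrow>
     graded_module R M \<and>
     (\<forall>i. d i \<in> graded_hom R (free_term R S (Suc i)) (free_term R S i)) \<and>
     e \<in> graded_hom R (free_term R S 0) M \<and>
     e ` carrier (free_term R S 0) = carrier M \<and>
     d 0 ` carrier (free_term R S 1) = a_kernel (free_term R S 0) M e \<and>
     (\<forall>i. d (Suc i) ` carrier (free_term R S (Suc (Suc i))) =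
            a_kernel (free_term R S (Suc i)) (free_term R S i) (d i))"

text \<open>
  Minimality \<open>d F\<^sub>i\<^sub>+\<^sub>1 \<subseteq> \<mm> F\<^sub>i\<close> with \<open>\<mm>\<close> the irrelevant ideal; this is the usual notion when \<open>R\<close> is a
  standard graded algebra over the field \<open>R\<^sub>0\<close>.
\<close>

definition minimal_graded_free_resolution ::
    "'a graded_ring \<Rightarrow> ('a, 'b) graded_module \<Rightarrow> int list list \<Rightarrow>
     (nat \<Rightarrow> (nat \<Rightarrow> 'a) \<Rightarrow> (nat \<Rightarrow> 'a)) \<Rightarrow> ((nat \<Rightarrow> 'a) \<Rightarrow> 'b) \<Rightarrow> bool" where
  "minimal_graded_free_resolution R M S d e \<longleftrightarrow>
     graded_free_resolution R M S d e \<and>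
     (\<forall>i. d i ` carrier (free_term R S (Suc i))
            \<subseteq> ideal_times R (irrelevant_ideal R) (free_term R S i))"


section \<open>Polynomial rings\<close>

text \<open>
  \<open>('v, 'k) mpoly\<close> consists of the polynomials over \<open>'k\<close> in indeterminates indexed by \<open>'v\<close>;
  \<open>poly_ring V\<close> is the standard graded ring \<open>K[x\<^sub>v | v \<in> V]\<close> inside it.
\<close>

type_synonym ('v, 'k) mpoly = "('v \<Rightarrow>\<^sub>0 nat) \<Rightarrow>\<^sub>0 'k"

definition indet :: "'v \<Rightarrow> ('v, 'k::field) mpoly" where
  "indet v = Poly_Mapping.single (Poly_Mapping.single v 1) 1"

definition mdeg :: "('v \<Rightarrow>\<^sub>0 nat) \<Rightarrow> nat" where
  "mdeg m = (\<Sum>v\<in>Poly_Mapping.keys m. Poly_Mapping.lookup m v)"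

definition poly_ring :: "'v set \<Rightarrow> ('v, 'k::field) mpoly graded_ring" where
  "poly_ring V =
    \<lparr>carrier = {p. \<forall>m\<in>Poly_Mapping.keys p. Poly_Mapping.keys m \<subseteq> V},
     monoid.mult = (*), monoid.one = 1, ring.zero = 0, ring.add = (+),
     ring_part = (\<lambda>n. {p. \<forall>m\<in>Poly_Mapping.keys p. Poly_Mapping.keys m \<subseteq> V \<and> int (mdeg m) = n})\<rparr>"


section \<open>Pfaffians of the generic skew-symmetric matrix\<close>

text \<open>
  The sum over all perfect matchings of \<open>{0, \<dots>, 2m - 1}\<close> (meaningful for alternating \<open>A\<close> of size \<open>2m\<close>).
  A matching is represented by the unique permutation \<open>p\<close> listing its edges as
  \<open>{p 0, p 1}, {p 2, p 3}, \<dots>\<close> with \<open>p (2i) < p (2i + 1)\<close> and \<open>p 0 < p 2 < p 4 < \<dots>\<close>.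
  No division is involved, so this is valid in every characteristic.
\<close>

definition matching_perms :: "nat \<Rightarrow> (nat \<Rightarrow> nat) set" where
  "matching_perms m = {p. p permutes {..<2 * m} \<and>
     (\<forall>i<m. p (2 * i) < p (2 * i + 1)) \<and>
     (\<forall>i j. i < j \<and> j < m \<longrightarrow> p (2 * i) < p (2 * j))}"

definition pfaffian :: "'a::comm_ring_1 mat \<Rightarrow> 'a" where
  "pfaffian A = (let m = dim_row A div 2 in
     \<Sum>p\<in>matching_perms m. of_int (sign p) * (\<Prod>i<m. A $$ (p (2 * i), p (2 * i + 1))))"

definition skew_vars :: "nat \<Rightarrow> (nat \<times> nat) set" where
  "skew_vars n = {(i, j). i < j \<and> j < n}"

definition generic_skew_mat :: "nat \<Rightarrow> (nat \<times> nat, 'k::field) mpoly mat" where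
  "generic_skew_mat n = mat n n (\<lambda>(i, j).
     if i < j then indet (i, j) else if j < i then - indet (j, i) else 0)"

text \<open>The ideal of \<open>K[X]\<close> generated by the \<open>2t\<close>-pfaffians of the generic \<open>n \<times> n\<close> matrix \<open>X\<close>.\<close>

definition pfaffian_ideal :: "nat \<Rightarrow> nat \<Rightarrow> (nat \<times> nat, 'k::field) mpoly set" where
  "pfaffian_ideal n t = genideal (poly_ring (skew_vars n))
     {pfaffian (submatrix (generic_skew_mat n) I I) | I. I \<subseteq> {..<n} \<and> card I = 2 * t}"

end

theory Submission
  imports Defs
begin

text \<open>
  Let \<open>X\<close> be the generic skew-symmetric matrix of size \<open>n = 2t + 1\<close> and let \<open>q\<close> be the vector with
  entries \<open>(-1)\<^sup>k Pf(X without row and column k)\<close>. The differentials of the resolution are \<open>q\<close>, \<open>X\<close>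
  and the transpose of \<open>q\<close>. Since the pfaffian vanishes on a repeated index, its first-row expansion
  gives \<open>X q = 0\<close>.

  Exactness is checked on the leading part with respect to the degree in the variables that lie off
  the cycle \<open>0 - 1 - \<dots> - (n - 1) - 0\<close>. There \<open>X\<close> becomes the skew-symmetric adjacency matrix of the
  cycle and \<open>q\<^sub>k\<close> becomes, up to sign, a product of alternate edges of the cycle without \<open>k\<close>. The leading
  complex is graded by monomials; in the degree of a monomial \<open>M\<close> it is the augmented chain complex of
  the subgraph of an \<open>n\<close>-cycle (the vertices in steps of two) spanned by those \<open>q\<^sub>k\<close> that divide \<open>M\<close>.
  This is empty, an arc or the whole cycle, because two separate arcs need \<open>2t + 2\<close> edges. A cycle
  of \<open>X\<close> or \<open>q\<close> can thus be corrected by a boundary so that its off-cycle order increases without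
  raising its total degree, which ends after finitely many steps.
\<close>

section \<open>Pfaffians indexed by lists\<close>

text \<open>An odd cycle is chosen because deleting any one of its vertices leaves a path with
  exactly one perfect matching. Each \<open>q k\<close> therefore has a single term of off-cycle
  order zero, with coefficient 1 or -1 in every characteristic. Exactness becomes a question about
  divisibility of squarefree monomials, and no depth estimate for the pfaffian ideal, as in the
  acyclicity criterion of Buchsbaum and Eisenbud, has to be made. Steps of two are forced by the
  matchings: the paths left by the vertices 2j and 2j + 2 have matchings that differ in one edge, so
  in this order the leading monomials are sliding windows of \<open>t\<close> consecutive edges.
  Since \<open>n\<close> is odd, 2 is invertible modulo \<open>n\<close> with inverse
  \<open>t + 1\<close>, which explains that constant throughout. Raising the order would not
  terminate on its own. The off-cycle degree of a monomial is at most its total degree, so every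
  correction has to be constructed together with a bound on its total degree; this is why the
  exactness statements for the cycle also describe the monomials of the solution.\<close>

definition drop_nth :: "nat \<Rightarrow> 'a list \<Rightarrow> 'a list" where
  "drop_nth k xs = take k xs @ drop (Suc k) xs"

lemma length_drop_nth [simp]: "k < length xs \<Longrightarrow> length (drop_nth k xs) = length xs - 1"
  by (simp add: drop_nth_def)

lemma nth_drop_nth:
  "\<lbrakk>k < length xs; i < length xs - 1\<rbrakk> \<Longrightarrow> drop_nth k xs ! i = xs ! (if i < k then i else Suc i)"
  by (auto simp: drop_nth_def nth_append min_def)

lemma drop_nth_0 [simp]: "drop_nth 0 (x # xs) = xs"
  by (simp add: drop_nth_def)

lemma drop_nth_Suc [simp]: "drop_nth (Suc k) (x # xs) = x # drop_nth k xs"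
  by (simp add: drop_nth_def)

lemma set_drop_nth: "set (drop_nth k xs) \<subseteq> set xs"
  unfolding drop_nth_def using set_take_subset[of k xs] set_drop_subset[of "Suc k" xs] by auto

lemma drop_nth_commute:
  assumes "l < k" "k < length xs"
  shows "drop_nth l (drop_nth k xs) = drop_nth (k - 1) (drop_nth l xs)"
  using assms by (intro nth_equalityI) (auto simp: nth_drop_nth)

text \<open>Lists instead of index sets make repeated and reordered indices meaningful; both are
  needed, for \<open>X q = 0\<close> and for the cyclic rotation of the indices.\<close>

function pf :: "('a \<Rightarrow> 'a \<Rightarrow> 'r) \<Rightarrow> 'a list \<Rightarrow> 'r::comm_ring_1" where
  "pf A [] = 1"
| "pf A (x # xs) = (\<Sum>k<length xs. (-1) ^ k * A x (xs ! k) * pf A (drop_nth k xs))"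
  by pat_completeness auto
termination by (relation "measure (length \<circ> snd)") auto

declare pf.simps(2) [simp del]

text \<open>Up to the sign \<open>(-1) ^ length us\<close>, the part of the first-row expansion of
  \<open>pf A (x # us @ ys)\<close> that runs over the columns \<open>ys\<close>.\<close>

definition pf_row :: "('a \<Rightarrow> 'a \<Rightarrow> 'r) \<Rightarrow> 'a \<Rightarrow> 'a list \<Rightarrow> 'a list \<Rightarrow> 'r::comm_ring_1" where
  "pf_row A x us ys = (\<Sum>k<length ys. (-1) ^ k * A x (ys ! k) * pf A (us @ drop_nth k ys))"

lemma pf_Cons: "pf A (x # xs) = pf_row A x [] xs"
  by (simp add: pf.simps(2) pf_row_def)

lemma pf_row_Nil [simp]: "pf_row A x us [] = 0"
  by (simp add: pf_row_def)

lemma pf_row_Cons: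
  "pf_row A x us (y # ys) = A x y * pf A (us @ ys) - pf_row A x (us @ [y]) ys"
  unfolding pf_row_def length_Cons by (subst sum.lessThan_Suc_shift) (simp add: sum_negf)

text \<open>Expanding along the rows of \<open>a\<close> and \<open>b\<close>, the part of \<open>pf (a # b # xs)\<close> without the entry
  \<open>A a b\<close> is the difference of a function of \<open>(a, b)\<close> and the same function of \<open>(b, a)\<close>. This also
  covers \<open>a = b\<close> in characteristic two.\<close>

lemma pf_row_swap:
  fixes A :: "'a \<Rightarrow> 'a \<Rightarrow> 'r::comm_ring_1"
  shows "\<exists>h. \<forall>a b. pf_row A a [b] xs = h a b - h b a"
proof -
  define N where "N = length xs"
  define g where "g a b k l = (-1) ^ (k + l) * A a (xs ! k) * A b (drop_nth k xs ! l)
      * pf A (drop_nth l (drop_nth k xs))" for a b k l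
  \<comment> \<open>The index \<open>l\<close> counts columns after column \<open>k\<close> has been
    removed, so exchanging the roles of the two rows sends \<open>(k, l)\<close> in \<open>U\<close>
    to \<open>(Suc l, k)\<close> in \<open>L\<close>. The shift by one is the source of the
    sign.\<close>
  define L U where "L = {(k, l). l < k \<and> k < N}" and "U = {(k, l). k \<le> l \<and> l < N - 1}"
  have fin: "finite L" "finite U"
    by (rule finite_subset[of _ "{..<N} \<times> {..<N}"]; auto simp: L_def U_def)+
  have row: "pf_row A a [b] xs = (\<Sum>(k, l)\<in>L. g a b k l) + (\<Sum>(k, l)\<in>U. g a b k l)" for a b
  proof -
    have "pf_row A a [b] xs = (\<Sum>k<N. \<Sum>l<N-1. g a b k l)"
      unfolding pf_row_def N_def g_def
      by (auto simp: pf.simps(2) sum_distrib_left power_add mult_ac intro!: sum.cong)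
    also have "\<dots> = (\<Sum>(k, l)\<in>{..<N} \<times> {..<N-1}. g a b k l)"
      by (simp add: sum.cartesian_product)
    also have "{..<N} \<times> {..<N-1} = L \<union> U"
      by (auto simp: L_def U_def)
    also have "(\<Sum>(k, l)\<in>L \<union> U. g a b k l) = (\<Sum>(k, l)\<in>L. g a b k l) + (\<Sum>(k, l)\<in>U. g a b k l)"
      using fin by (intro sum.union_disjoint) (auto simp: L_def U_def)
    finally show ?thesis .
  qed
  have upper: "(\<Sum>(k, l)\<in>U. g a b k l) = - (\<Sum>(k, l)\<in>L. g b a k l)" for a b
  proof -
    have "(\<Sum>(k, l)\<in>U. g a b k l) = (\<Sum>(k, l)\<in>L. - g b a k l)"
    proof (rule sum.reindex_bij_witness[where i = "\<lambda>(k, l). (l, k - 1)" and j = "\<lambda>(k, l). (Suc l, k)"])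
      fix p assume p: "p \<in> U"
      then obtain k l where kl: "p = (k, l)" "k \<le> l" "l < N - 1" by (auto simp: U_def)
      have "drop_nth k (drop_nth (Suc l) xs) = drop_nth l (drop_nth k xs)"
        using drop_nth_commute[of k "Suc l" xs] kl by (simp add: N_def)
      then show "(case case p of (k, l) \<Rightarrow> (Suc l, k) of (k, l) \<Rightarrow> - g b a k l) = (case p of (k, l) \<Rightarrow> g a b k l)"
        using kl by (simp add: g_def nth_drop_nth N_def mult_ac add.commute)
    qed (auto simp: U_def L_def)
    then show ?thesis by (simp add: sum_negf case_prod_unfold)
  qed
  show ?thesis
    by (intro exI[of _ "\<lambda>a b. \<Sum>(k, l)\<in>L. g a b k l"]) (simp add: row upper)
qed

text \<open>The condition on the diagonal is separate because skew-symmetry does not imply it in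
  characteristic two.\<close>

definition alternating_form :: "('a \<Rightarrow> 'a \<Rightarrow> 'r::comm_ring_1) \<Rightarrow> bool" where
  "alternating_form A \<longleftrightarrow> (\<forall>x. A x x = 0) \<and> (\<forall>x y. A x y = - A y x)"

lemma pf_row_cong_neg:
  assumes "\<And>k. k < length ys \<Longrightarrow> pf A (us @ drop_nth k ys) = - pf A (vs @ drop_nth k ys)"
  shows "pf_row A x us ys = - pf_row A x vs ys"
  using assms by (simp add: pf_row_def sum_negf)

text \<open>At the head of the list the entry \<open>A a b\<close> changes sign, and the rest is
  antisymmetric by \<open>pf_row_swap\<close>. Further inside, the first row is expanded: either
  \<open>a\<close> and \<open>b\<close> both survive as neighbours in a shorter list, or one of them
  is the chosen column and its position has moved by one.\<close>

lemma pf_swap: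
  assumes A: "alternating_form A"
  shows "pf A (us @ a # b # vs) = - pf A (us @ b # a # vs)"
proof (induction "length us + length vs" arbitrary: us vs a b rule: less_induct)
  case less
  show ?case
  proof (cases us)
    case Nil
    obtain h where h: "\<And>a b. pf_row A a [b] vs = h a b - h b a" using pf_row_swap by metis
    have "A a b = - A b a" using A unfolding alternating_form_def by blast
    then show ?thesis by (simp add: Nil pf_Cons pf_row_Cons h)
  next
    case (Cons x us')
    \<comment> \<open>The prefix \<open>ws\<close> collects the columns already passed, so that the
      induction can walk through the columns in front of the swapped pair.\<close>
    have "pf_row A x ws (ys @ a # b # vs) = - pf_row A x ws (ys @ b # a # vs)"
      if "length ws + length ys \<le> length us'" for ws ys
      using that
    proof (induction ys arbitrary: ws)
      case Nil
      have "pf_row A x (ws @ [a, b]) vs = - pf_row A x (ws @ [b, a]) vs"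
      proof (rule pf_row_cong_neg)
        fix k assume "k < length vs"
        then show "pf A ((ws @ [a, b]) @ drop_nth k vs) = - pf A ((ws @ [b, a]) @ drop_nth k vs)"
          using less.hyps[of ws "drop_nth k vs" a b] Nil \<open>us = x # us'\<close> by simp
      qed
      then show ?case by (simp add: pf_row_Cons)
    next
      case (Cons y ys)
      have "pf_row A x (ws @ [y]) (ys @ a # b # vs) = - pf_row A x (ws @ [y]) (ys @ b # a # vs)"
        using Cons by simp
      moreover have "pf A ((ws @ ys) @ a # b # vs) = - pf A ((ws @ ys) @ b # a # vs)"
        using Cons \<open>us = x # us'\<close> by (intro less.hyps) simp
      ultimately show ?case by (simp add: pf_row_Cons)
    qed
    from this[of "[]" us'] show ?thesis by (simp add: Cons pf_Cons)
  qed
qed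

lemma pf_move:
  assumes A: "alternating_form A"
  shows "pf A (ps @ us @ x # vs) = (-1) ^ length us * pf A (ps @ x # us @ vs)"
proof (induction us arbitrary: vs rule: rev_induct)
  case (snoc u us)
  have "pf A (ps @ (us @ [u]) @ x # vs) = - pf A (ps @ us @ x # u # vs)"
    using pf_swap[OF A, of "ps @ us" u x vs] by simp
  then show ?case using snoc[of "u # vs"] by simp
qed simp

lemma pf_swap_blocks:
  assumes A: "alternating_form A"
  shows "pf A (ps @ us @ vs) = (-1) ^ (length us * length vs) * pf A (ps @ vs @ us)"
proof (induction vs arbitrary: ps)
  case (Cons v vs)
  have "pf A (ps @ us @ v # vs) = (-1) ^ length us * pf A ((ps @ [v]) @ us @ vs)"
    using pf_move[OF A, of ps us v vs] by simp
  then show ?case unfolding Cons by (simp add: power_add mult.assoc)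
qed simp

text \<open>Antisymmetry alone would only show that twice the pfaffian vanishes. Moved next to its
  copy, \<open>x\<close> contributes \<open>A x x = 0\<close> and the difference
  \<open>h x x - h x x\<close>, which is zero in every characteristic.\<close>

lemma pf_repeated:
  assumes A: "alternating_form A" and x: "x \<in> set ys"
  shows "pf A (x # ys) = 0"
proof -
  obtain us vs where ys: "ys = us @ x # vs" using split_list[OF x] by blast
  obtain h where h: "\<And>a b. pf_row A a [b] (us @ vs) = h a b - h b a" using pf_row_swap by metis
  have "A x x = 0" using A unfolding alternating_form_def by blast
  then have "pf A (x # x # us @ vs) = 0"
    by (simp add: pf_Cons[of A x "x # us @ vs"] pf_row_Cons h)
  then show ?thesis using pf_move[OF A, of "[x]" us x vs] by (simp add: ys)
qed

section \<open>Pfaffians as sums over perfect matchings\<close>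

definition matching_sum :: "nat \<Rightarrow> (nat \<Rightarrow> nat \<Rightarrow> 'r::comm_ring_1) \<Rightarrow> 'r" where
  "matching_sum m a = (\<Sum>p\<in>matching_perms m. of_int (sign p) * (\<Prod>i<m. a (p (2 * i)) (p (2 * i + 1))))"

text \<open>A perfect matching of \<open>{0, \<dots>, 2m + 1}\<close> consists of an edge \<open>{0, j + 1}\<close> and a matching of
  the remaining points, relabelled by \<open>skip j\<close>. On listing permutations this is \<open>add_pair j\<close>,
  and the cycle \<open>front_cycle j\<close> accounts for the sign of the expansion.\<close>

definition skip :: "nat \<Rightarrow> nat \<Rightarrow> nat" where
  "skip j x = (if x < j then Suc x else Suc (Suc x))"

definition front_cycle :: "nat \<Rightarrow> nat \<Rightarrow> nat" where
  "front_cycle j x = (if x = 0 then 0 else if x = 1 then Suc j else if x \<le> Suc j then x - 1 else x)"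

definition add_pair :: "nat \<Rightarrow> (nat \<Rightarrow> nat) \<Rightarrow> nat \<Rightarrow> nat" where
  "add_pair j p x = (if x = 0 then 0 else if x = 1 then Suc j else skip j (p (x - 2)))"

lemma skip_less_iff [simp]: "skip j x < skip j y \<longleftrightarrow> x < y"
  by (auto simp: skip_def)

lemma skip_eq_iff [simp]: "skip j x = skip j y \<longleftrightarrow> x = y"
  by (auto simp: skip_def)

lemma skip_pos [simp]: "0 < skip j x"
  by (auto simp: skip_def)

lemma add_pair_simps [simp]:
  "add_pair j p 0 = 0" "add_pair j p (Suc 0) = Suc j" "add_pair j p (Suc (Suc x)) = skip j (p x)"
  by (auto simp: add_pair_def)

lemma front_cycle_Suc: "front_cycle (Suc j) = Transposition.transpose (Suc j) (Suc (Suc j)) \<circ> front_cycle j"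
  by (rule ext) (auto simp: front_cycle_def Transposition.transpose_def)

lemma front_cycle_permutes: "Suc j < n \<Longrightarrow> front_cycle j permutes {..<n}"
proof (induction j)
  case 0
  have "front_cycle 0 = id" by (auto simp: front_cycle_def)
  then show ?case by (simp only: permutes_id)
next
  case (Suc j)
  then show ?case unfolding front_cycle_Suc
    by (intro permutes_compose) (auto intro: permutes_swap_id)
qed

lemma sign_front_cycle: "sign (front_cycle j) = (-1) ^ j"
proof (induction j)
  case 0
  have "front_cycle 0 = id" by (auto simp: front_cycle_def)
  then show ?case by simp
next
  case (Suc j)
  have "front_cycle j permutes {..<Suc (Suc j)}" by (rule front_cycle_permutes) simp
  then have "permutation (front_cycle j)" by (rule permutation_permutes[THEN iffD2, OF exI, OF conjI, rotated]) simp
  then show ?case unfolding front_cycle_Suc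
    by (subst sign_compose) (simp_all add: permutation_swap_id sign_swap_id Suc)
qed

text \<open>Since \<open>skip j y = front_cycle j (y + 2)\<close>, adding an edge is a shift by two
  points followed by a cycle. The shift preserves the sign, so the sign of the expansion is that of
  the cycle.\<close>

lemma add_pair_eq:
  assumes "p permutes {..<n}"
  shows "add_pair j p = front_cycle j \<circ> map_permutation {..<n} (\<lambda>x. Suc (Suc x)) p"
proof
  fix x
  show "add_pair j p x = (front_cycle j \<circ> map_permutation {..<n} (\<lambda>x. Suc (Suc x)) p) x"
  proof (cases "x < 2")
    case True
    then have "x \<notin> (\<lambda>x. Suc (Suc x)) ` {..<n}" by auto
    then have "map_permutation {..<n} (\<lambda>x. Suc (Suc x)) p x = x"
      by (simp add: map_permutation_def restrict_id_def)
    with True show ?thesis by (auto simp: add_pair_def front_cycle_def)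
  next
    case False
    then have "x = Suc (Suc (x - 2))" by simp
    then obtain y where x: "x = Suc (Suc y)" by blast
    have "map_permutation {..<n} (\<lambda>x. Suc (Suc x)) p x = Suc (Suc (p y))"
    proof (cases "y < n")
      case True
      then show ?thesis unfolding x by (subst map_permutation_apply) (auto simp: inj_on_def)
    next
      case False
      then have "x \<notin> (\<lambda>x. Suc (Suc x)) ` {..<n}" using x by auto
      moreover have "p y = y" using False assms by (simp add: permutes_not_in)
      ultimately show ?thesis by (simp add: map_permutation_def restrict_id_def x)
    qed
    then show ?thesis by (simp add: x front_cycle_def skip_def)
  qed
qed

lemma bij_betw_Suc_Suc: "bij_betw (\<lambda>x. Suc (Suc x)) {..<n} {2..<Suc (Suc n)}"
  by (rule bij_betw_byWitness[where f' = "\<lambda>x. x - 2"]) auto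

lemma
  assumes p: "p permutes {..<n}" and j: "j < Suc n"
  shows add_pair_permutes: "add_pair j p permutes {..<Suc (Suc n)}"
    and sign_add_pair: "sign (add_pair j p) = (-1) ^ j * sign p"
proof -
  let ?q = "map_permutation {..<n} (\<lambda>x. Suc (Suc x)) p"
  have "?q permutes {2..<Suc (Suc n)}"
    by (rule map_permutation_permutes[OF bij_betw_Suc_Suc p])
  then have q: "?q permutes {..<Suc (Suc n)}" by (rule permutes_subset) auto
  have c: "front_cycle j permutes {..<Suc (Suc n)}" using j by (intro front_cycle_permutes) simp
  show "add_pair j p permutes {..<Suc (Suc n)}"
    unfolding add_pair_eq[OF p] by (rule permutes_compose[OF q c])
  have "permutation ?q" "permutation (front_cycle j)"
    using q c finite_lessThan permutation_permutes by blast+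
  moreover have "sign ?q = sign p" by (rule sign_map_permutation) (use p in \<open>auto simp: inj_on_def\<close>)
  ultimately show "sign (add_pair j p) = (-1) ^ j * sign p"
    unfolding add_pair_eq[OF p] by (simp add: sign_compose sign_front_cycle)
qed

lemma matching_perms_permutes: "p \<in> matching_perms m \<Longrightarrow> p permutes {..<2 * m}"
  by (simp add: matching_perms_def)

lemma add_pair_in_matching_perms:
  assumes p: "p \<in> matching_perms m" and j: "j < 2 * m + 1"
  shows "add_pair j p \<in> matching_perms (Suc m)"
  unfolding matching_perms_def
proof (intro CollectI conjI allI impI)
  show "add_pair j p permutes {..<2 * Suc m}"
    using add_pair_permutes[OF matching_perms_permutes[OF p], of j] j by simp
  show "add_pair j p (2 * i) < add_pair j p (2 * i + 1)" if "i < Suc m" for i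
    using p that by (cases i) (auto simp: matching_perms_def)
  show "add_pair j p (2 * i) < add_pair j p (2 * k)" if "i < k \<and> k < Suc m" for i k
    using p that by (cases i; cases k) (auto simp: matching_perms_def)
qed

text \<open>The value 0 cannot be the larger point of an edge, and the smaller points of the edges
  increase, so it belongs to the first edge.\<close>

lemma matching_perms_0: 
  assumes p: "p \<in> matching_perms (Suc m)"
  shows "p 0 = 0"
proof -
  from p have perm: "p permutes {..<2 * Suc m}" and less: "\<And>i. i < Suc m \<Longrightarrow> p (2 * i) < p (2 * i + 1)"
    and mono: "\<And>i j. i < j \<Longrightarrow> j < Suc m \<Longrightarrow> p (2 * i) < p (2 * j)"
    by (auto simp: matching_perms_def)
  have "0 \<in> p ` {..<2 * Suc m}" using permutes_image[OF perm] by simp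
  then obtain x where x: "x < 2 * Suc m" "p x = 0" by auto
  show ?thesis
  proof (cases "even x")
    case True
    then obtain i where i: "x = 2 * i" by (auto elim: evenE)
    then show ?thesis using mono[of 0 i] x by (cases "i = 0") auto
  next
    case False
    then obtain i where i: "x = 2 * i + 1" by (auto elim: oddE)
    then show ?thesis using less[of i] x by auto
  qed
qed

lemma matching_perms_Suc_cases:
  assumes p: "p \<in> matching_perms (Suc m)"
  obtains j q where "j < 2 * m + 1" "q \<in> matching_perms m" "p = add_pair j q"
proof -
  from p have perm: "p permutes {..<Suc (Suc (2 * m))}" and less: "\<And>i. i < Suc m \<Longrightarrow> p (2 * i) < p (2 * i + 1)"
    and mono: "\<And>i j. i < j \<Longrightarrow> j < Suc m \<Longrightarrow> p (2 * i) < p (2 * j)"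
    by (auto simp: matching_perms_def)
  have p0: "p 0 = 0" by (rule matching_perms_0[OF p])
  define j where "j = p 1 - 1"
  have p1: "p 1 = Suc j" using less[of 0] p0 by (simp add: j_def)
  have "p 1 < Suc (Suc (2 * m))" using permutes_in_image[OF perm, of 1] by simp
  then have j: "j < 2 * m + 1" using p1 by simp
  have c: "front_cycle j permutes {..<Suc (Suc (2 * m))}" using j by (intro front_cycle_permutes) simp
  \<comment> \<open>Undoing the cycle leaves a permutation that fixes 0 and 1, hence a shifted copy
    of a permutation \<open>q\<close> of \<open>2 * m\<close> points.\<close>
  define r where "r = inv_into UNIV (front_cycle j) \<circ> p"
  have r: "r permutes {..<Suc (Suc (2 * m))}"
    unfolding r_def by (rule permutes_compose[OF perm permutes_inv[OF c]])
  have "r 0 = 0" "r 1 = 1"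
    using p0 p1 by (auto simp: r_def permutes_inv_eq[OF c] front_cycle_def)
  then have r2: "r permutes {2..<Suc (Suc (2 * m))}"
    by (intro permutes_superset[OF r]) (auto simp: less_2_cases_iff not_le)
  define q where "q = map_permutation {2..<Suc (Suc (2 * m))} (\<lambda>x. x - 2) r"
  have bij: "bij_betw (\<lambda>x. x - 2) {2..<Suc (Suc (2 * m))} {..<2 * m}"
    by (rule bij_betw_byWitness[where f' = "\<lambda>x. x + 2"]) auto
  have q: "q permutes {..<2 * m}"
    unfolding q_def by (rule map_permutation_permutes[OF bij r2])
  have rq: "map_permutation {..<2 * m} (\<lambda>x. Suc (Suc x)) q = r"
    unfolding q_def by (rule map_permutation_compose_inv[OF bij r2]) auto
  have pq: "p = add_pair j q"
    unfolding add_pair_eq[OF q] rq r_def by (simp add: o_assoc permutes_inv_o(1)[OF c])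
  have "q \<in> matching_perms m"
    unfolding matching_perms_def
  proof (intro CollectI conjI allI impI)
    show "q (2 * i) < q (2 * i + 1)" if "i < m" for i
      using less[of "Suc i"] that by (simp add: pq)
    show "q (2 * i) < q (2 * k)" if "i < k \<and> k < m" for i k
      using mono[of "Suc i" "Suc k"] that by (simp add: pq)
  qed (rule q)
  with j pq show thesis using that by blast
qed

text \<open>Sorting the matchings by the partner of the point 0 yields the recursion that defines
  \<open>pf\<close>.\<close>

lemma matching_sum_Suc:
  "matching_sum (Suc m) a =
     (\<Sum>j<2 * m + 1. (-1) ^ j * a 0 (Suc j) * matching_sum m (\<lambda>x y. a (skip j x) (skip j y)))"
proof -
  let ?f = "\<lambda>p. of_int (sign p) * (\<Prod>i<Suc m. a (p (2 * i)) (p (2 * i + 1)))"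
  have bij: "bij_betw (\<lambda>(j, p). add_pair j p) ({..<2 * m + 1} \<times> matching_perms m) (matching_perms (Suc m))"
    unfolding bij_betw_def
  proof
    show "inj_on (\<lambda>(j, p). add_pair j p) ({..<2 * m + 1} \<times> matching_perms m)"
    proof (rule inj_onI, clarsimp)
      fix j p k q assume eq: "add_pair j p = add_pair k q"
      have "j = k" using fun_cong[OF eq, of 1] by simp
      moreover have "p x = q x" for x using fun_cong[OF eq, of "Suc (Suc x)"] \<open>j = k\<close> by simp
      ultimately show "j = k \<and> p = q" by auto
    qed
    show "(\<lambda>(j, p). add_pair j p) ` ({..<2 * m + 1} \<times> matching_perms m) = matching_perms (Suc m)"
    proof (intro equalityI subsetI)
      fix p assume "p \<in> matching_perms (Suc m)"
      then obtain j q where "j < 2 * m + 1" "q \<in> matching_perms m" "p = add_pair j q"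
        by (rule matching_perms_Suc_cases)
      then show "p \<in> (\<lambda>(j, p). add_pair j p) ` ({..<2 * m + 1} \<times> matching_perms m)"
        by (intro image_eqI[of _ _ "(j, q)"]) auto
    qed (auto simp: add_pair_in_matching_perms)
  qed
  have "?f (add_pair j p) = (-1) ^ j * a 0 (Suc j)
      * (of_int (sign p) * (\<Prod>i<m. a (skip j (p (2 * i))) (skip j (p (2 * i + 1)))))"
    if "j < 2 * m + 1" "p \<in> matching_perms m" for j p
    using that sign_add_pair[OF matching_perms_permutes[of p m], of j]
    by (simp add: prod.lessThan_Suc_shift mult_ac del: prod.lessThan_Suc)
  then have "matching_sum (Suc m) a = (\<Sum>(j, p)\<in>{..<2 * m + 1} \<times> matching_perms m. (-1) ^ j * a 0 (Suc j)
      * (of_int (sign p) * (\<Prod>i<m. a (skip j (p (2 * i))) (skip j (p (2 * i + 1))))))"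
    unfolding matching_sum_def sum.reindex_bij_betw[OF bij, symmetric] by (intro sum.cong) auto
  then show ?thesis
    by (simp add: sum.cartesian_product[symmetric] matching_sum_def sum_distrib_left del: sum.lessThan_Suc)
qed

lemma matching_sum_cong:
  assumes "\<And>x y. x < 2 * m \<Longrightarrow> y < 2 * m \<Longrightarrow> a x y = b x y"
  shows "matching_sum m a = matching_sum m b"
proof -
  have "p x < 2 * m" if "p \<in> matching_perms m" "x < 2 * m" for p x
    using permutes_in_image[OF matching_perms_permutes[OF that(1)], of x] that(2) by simp
  then show ?thesis unfolding matching_sum_def
    by (intro sum.cong arg_cong2[where f = "(*)"] prod.cong refl assms) auto
qed

lemma matching_sum_eq_pf:
  "length xs = 2 * m \<Longrightarrow> matching_sum m (\<lambda>x y. A (xs ! x) (xs ! y)) = pf A xs"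
proof (induction m arbitrary: xs)
  case 0
  have "matching_perms 0 = {id}" by (auto simp: matching_perms_def)
  with 0 show ?case by (simp add: matching_sum_def)
next
  case (Suc m)
  then obtain x ys where xs: "xs = x # ys" and ys: "length ys = 2 * m + 1" by (cases xs) auto
  have "matching_sum m (\<lambda>u v. A (xs ! skip j u) (xs ! skip j v)) = pf A (drop_nth j ys)" if "j < 2 * m + 1" for j
  proof -
    have "matching_sum m (\<lambda>u v. A (xs ! skip j u) (xs ! skip j v))
        = matching_sum m (\<lambda>u v. A (drop_nth j ys ! u) (drop_nth j ys ! v))"
      by (rule matching_sum_cong) (use ys that in \<open>auto simp: xs skip_def nth_drop_nth\<close>)
    also have "\<dots> = pf A (drop_nth j ys)" by (rule Suc.IH) (use ys that in simp)
    finally show ?thesis .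
  qed
  then show ?case by (simp add: matching_sum_Suc xs pf.simps(2) ys del: sum.lessThan_Suc)
qed

lemma pfaffian_eq_pf:
  assumes "length xs = 2 * m" "dim_row B = 2 * m"
    and "\<And>x y. x < 2 * m \<Longrightarrow> y < 2 * m \<Longrightarrow> B $$ (x, y) = A (xs ! x) (xs ! y)"
  shows "pfaffian B = pf A xs"
proof -
  have "pfaffian B = matching_sum m (\<lambda>x y. B $$ (x, y))"
    using assms(2) by (simp add: pfaffian_def matching_sum_def Let_def)
  also have "\<dots> = matching_sum m (\<lambda>x y. A (xs ! x) (xs ! y))"
    by (rule matching_sum_cong) (rule assms(3))
  also have "\<dots> = pf A xs" by (rule matching_sum_eq_pf[OF assms(1)])
  finally show ?thesis .
qed

lemma pick_delete:
  assumes "i < n" "x < n - 1"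
  shows "pick ({..<n} - {i}) x = (if x < i then x else Suc x)"
proof -
  let ?y = "if x < i then x else Suc x"
  have "{a \<in> {..<n} - {i}. a < ?y} = (if x < i then {..<x} else {..<Suc x} - {i})" using assms by auto
  then have card: "card {a \<in> {..<n} - {i}. a < ?y} = x" using assms by auto
  have "?y \<in> {..<n} - {i}" using assms by auto
  from pick_card_in_set[OF this] show ?thesis unfolding card .
qed

lemma pfaffian_submatrix_delete:
  assumes n: "n = 2 * t + 1" and i: "i < n" and B: "dim_row B = n" "dim_col B = n"
    and A: "\<And>x y. x < n \<Longrightarrow> y < n \<Longrightarrow> B $$ (x, y) = A x y"
  shows "pfaffian (submatrix B ({..<n} - {i}) ({..<n} - {i})) = pf A (drop_nth i [0..<n])"
proof -
  let ?I = "{..<n} - {i}"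
  have card: "card {a. a < n \<and> a \<in> ?I} = 2 * t"
  proof -
    have "{a. a < n \<and> a \<in> ?I} = ?I" by auto
    then show ?thesis using i n by simp
  qed
  show ?thesis
  proof (rule pfaffian_eq_pf)
    show "length (drop_nth i [0..<n]) = 2 * t" using i n by simp
    show "dim_row (submatrix B ?I ?I) = 2 * t" using B card by (simp add: dim_submatrix)
    fix x y assume xy: "x < 2 * t" "y < 2 * t"
    have "submatrix B ?I ?I $$ (x, y) = B $$ (pick ?I x, pick ?I y)"
      by (rule submatrix_index) (use B card xy in auto)
    also have "\<dots> = A (drop_nth i [0..<n] ! x) (drop_nth i [0..<n] ! y)"
      using xy i n by (simp add: pick_delete A nth_drop_nth del: upt_Suc)
    finally show "submatrix B ?I ?I $$ (x, y) = A (drop_nth i [0..<n] ! x) (drop_nth i [0..<n] ! y)" .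
  qed
qed

section \<open>The complex of a cycle of edges\<close>

lemma poly_mapping_sum_singles:
  "p = (\<Sum>m\<in>Poly_Mapping.keys p. Poly_Mapping.single m (Poly_Mapping.lookup p m))"
  by (rule poly_mapping_eqI)
    (auto simp: lookup_sum lookup_single when_def in_keys_iff)

lemma lookup_single_times:
  fixes p :: "('a::cancel_comm_monoid_add) \<Rightarrow>\<^sub>0 ('b::comm_ring_1)"
  shows "Poly_Mapping.lookup (Poly_Mapping.single L s * p) (L + m) = s * Poly_Mapping.lookup p m"
proof -
  have "Poly_Mapping.single L s * p
      = (\<Sum>m\<in>Poly_Mapping.keys p. Poly_Mapping.single (L + m) (s * Poly_Mapping.lookup p m))"
    by (subst poly_mapping_sum_singles[of p]) (simp add: sum_distrib_left mult_single)
  then show ?thesis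
    by (simp add: lookup_sum lookup_single when_def in_keys_iff)
qed

lemma keys_single_times:
  "M \<in> Poly_Mapping.keys (Poly_Mapping.single L s * p) \<Longrightarrow> \<exists>m\<in>Poly_Mapping.keys p. M = L + m"
  using keys_mult[of "Poly_Mapping.single L s" p] by (auto split: if_splits)

lemma single_times_cancel:
  fixes p q :: "('a::cancel_comm_monoid_add) \<Rightarrow>\<^sub>0 ('b::field)"
  assumes "Poly_Mapping.single L s * p = Poly_Mapping.single L s * q" "s \<noteq> 0"
  shows "p = q"
proof (rule poly_mapping_eqI)
  fix m
  show "Poly_Mapping.lookup p m = Poly_Mapping.lookup q m"
    using lookup_single_times[of L s p m] lookup_single_times[of L s q m] assms by simp
qed

text \<open>The quotient is the pullback of \<open>p\<close> along translation by \<open>L\<close>,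
  divided by \<open>s\<close>. The second conclusion lets degree bounds pass from \<open>p\<close>
  to the quotient.\<close>

lemma single_times_quotient:
  fixes p :: "('a::cancel_comm_monoid_add) \<Rightarrow>\<^sub>0 ('b::field)"
  assumes "\<And>M. M \<in> Poly_Mapping.keys p \<Longrightarrow> \<exists>m. M = L + m" and "s \<noteq> 0"
  obtains q where "p = Poly_Mapping.single L s * q" "\<And>m. m \<in> Poly_Mapping.keys q \<Longrightarrow> L + m \<in> Poly_Mapping.keys p"
proof
  have inj: "inj ((+) L)" by (simp add: inj_on_def)
  let ?q = "Poly_Mapping.single 0 (1 / s) * Poly_Mapping.map_key ((+) L) p"
  have lookup: "Poly_Mapping.lookup ?q m = Poly_Mapping.lookup p (L + m) / s" for m
    using lookup_single_times[of 0 "1 / s" "Poly_Mapping.map_key ((+) L) p" m]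
    by (simp add: map_key.rep_eq[OF inj])
  show "p = Poly_Mapping.single L s * ?q"
  proof (rule poly_mapping_eqI)
    fix M
    show "Poly_Mapping.lookup p M = Poly_Mapping.lookup (Poly_Mapping.single L s * ?q) M"
    proof (cases "\<exists>m. M = L + m")
      case True
      then obtain m where M: "M = L + m" by blast
      show ?thesis unfolding M lookup_single_times lookup using \<open>s \<noteq> 0\<close> by simp
    next
      case False
      then have "M \<notin> Poly_Mapping.keys p" "M \<notin> Poly_Mapping.keys (Poly_Mapping.single L s * ?q)"
        using assms(1) keys_single_times by blast+
      then show ?thesis by (simp add: in_keys_iff)
    qed
  qed
  show "L + m \<in> Poly_Mapping.keys p" if "m \<in> Poly_Mapping.keys ?q" for m
    using that by (auto simp: in_keys_iff lookup)
qed

definition poly_filter :: "('a \<Rightarrow> bool) \<Rightarrow> ('a \<Rightarrow>\<^sub>0 'b::zero) \<Rightarrow> 'a \<Rightarrow>\<^sub>0 'b" where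
  "poly_filter P = Poly_Mapping.mapp (\<lambda>m c. if P m then c else 0)"

lemma lookup_poly_filter [simp]:
  "Poly_Mapping.lookup (poly_filter P p) m = (if P m then Poly_Mapping.lookup p m else 0)"
  by (auto simp: poly_filter_def lookup_mapp when_def in_keys_iff)

lemma keys_poly_filter [simp]: "Poly_Mapping.keys (poly_filter P p) = {m \<in> Poly_Mapping.keys p. P m}"
  by (auto simp: in_keys_iff split: if_splits)

text \<open>In the application the vertices of the cycle \<open>0, 1, \<dots>, n - 1\<close> are visited in steps of two:
  \<open>\<phi> j\<close> is the entry of the matrix at \<open>(2j, 2j + 1)\<close> modulo \<open>n\<close>, \<open>\<omega> j\<close> is the pfaffian of the
  path that remains when the vertex \<open>2j\<close> is removed from the cycle, and \<open>\<Lambda> j\<close> is the least common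
  multiple of \<open>\<omega> j\<close> and \<open>\<omega> (j + 1)\<close>.\<close>

locale edge_cycle =
  fixes t :: nat and n :: int and var :: "int \<Rightarrow> 'v" and \<sigma> :: "int \<Rightarrow> 'k::field"
  assumes n_def: "n = 2 * int t + 1"
    and var_eq_iff: "var x = var y \<longleftrightarrow> x mod n = y mod n"
    and \<sigma>_mod: "\<sigma> (x mod n) = \<sigma> x"
    and \<sigma>_nonzero [simp]: "\<sigma> x \<noteq> 0"
begin

definition \<phi> :: "int \<Rightarrow> ('v, 'k) mpoly" where
  "\<phi> x = Poly_Mapping.single (Poly_Mapping.single (var x) 1) (\<sigma> x)"

definition mon :: "int set \<Rightarrow> 'v \<Rightarrow>\<^sub>0 nat" where
  "mon S = (\<Sum>x\<in>S. Poly_Mapping.single (var x) 1)"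

definition \<omega> :: "int \<Rightarrow> ('v, 'k) mpoly" where
  "\<omega> j = (\<Prod>x\<in>{j - int t..<j}. \<phi> x)"

definition \<Lambda> :: "int \<Rightarrow> ('v, 'k) mpoly" where
  "\<Lambda> j = (\<Prod>x\<in>{j - int t..j}. \<phi> x)"

lemma n_pos: "n > 0"
  by (simp add: n_def)

lemma var_mod: "var (x mod n) = var x"
  by (simp add: var_eq_iff)

lemma \<phi>_mod: "\<phi> (x mod n) = \<phi> x"
  by (simp add: \<phi>_def \<sigma>_mod var_mod)

lemma prod_\<phi>: "finite S \<Longrightarrow> (\<Prod>x\<in>S. \<phi> x) = Poly_Mapping.single (mon S) (\<Prod>x\<in>S. \<sigma> x)"
  by (induction S rule: finite_induct) (simp_all add: \<phi>_def mon_def mult_single)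

lemma \<omega>_eq: "\<omega> j = Poly_Mapping.single (mon {j - int t..<j}) (\<Prod>x\<in>{j - int t..<j}. \<sigma> x)"
  by (simp add: \<omega>_def prod_\<phi>)

lemma \<Lambda>_eq: "\<Lambda> j = Poly_Mapping.single (mon {j - int t..j}) (\<Prod>x\<in>{j - int t..j}. \<sigma> x)"
  by (simp add: \<Lambda>_def prod_\<phi>)

lemma \<omega>_cancel: "\<omega> j * p = \<omega> j * q \<Longrightarrow> p = q"
  unfolding \<omega>_eq by (erule single_times_cancel) simp

lemma \<Lambda>_cancel: "\<Lambda> j * p = \<Lambda> j * q \<Longrightarrow> p = q"
  unfolding \<Lambda>_eq by (erule single_times_cancel) simp

text \<open>Lengthening the window of \<open>\<omega> j\<close> by one edge at either end gives the
  two neighbouring least common multiples. The added edges are the cofactors of the syzygies between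
  consecutive \<open>\<omega>\<close>.\<close>

lemma \<omega>_\<phi>_right: "\<omega> j * \<phi> j = \<Lambda> j"
proof -
  have "{j - int t..j} = insert j {j - int t..<j}" by auto
  then show ?thesis by (simp add: \<omega>_def \<Lambda>_def mult.commute)
qed

lemma \<omega>_\<phi>_left: "\<omega> j * \<phi> (j - 1 - int t) = \<Lambda> (j - 1)"
proof -
  have "{j - 1 - int t..j - 1} = insert (j - 1 - int t) {j - int t..<j}" by auto
  then show ?thesis by (simp add: \<omega>_def \<Lambda>_def mult.commute)
qed

lemma lookup_mon_pos: "finite S \<Longrightarrow> x \<in> S \<Longrightarrow> 0 < Poly_Mapping.lookup (mon S) (var x)"
  by (auto simp: mon_def lookup_sum lookup_single when_def intro!: sum_pos2[where i = x])

text \<open>By injectivity of \<open>var\<close> on \<open>S\<close> the monomial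
  \<open>mon S\<close> is squarefree, so divisibility only asks which variables occur.\<close>

lemma mon_dvd:
  assumes S: "finite S" "inj_on var S" and M: "\<And>x. x \<in> S \<Longrightarrow> 0 < Poly_Mapping.lookup M (var x)"
  shows "\<exists>m. M = mon S + m"
proof
  have le: "Poly_Mapping.lookup (mon S) v \<le> Poly_Mapping.lookup M v" for v
  proof (cases "\<exists>x\<in>S. v = var x")
    case True
    then obtain x where x: "x \<in> S" "v = var x" by blast
    have "Poly_Mapping.lookup (mon S) v = (\<Sum>y\<in>S. if y = x then 1 else 0)"
      unfolding mon_def lookup_sum using S(2) x
      by (intro sum.cong) (auto simp: lookup_single when_def inj_on_def)
    also have "\<dots> = 1" using S x by simp
    finally show ?thesis using M[OF x(1)] x by simp
  next
    case False
    then have "Poly_Mapping.lookup (mon S) v = 0"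
      unfolding mon_def lookup_sum by (intro sum.neutral) (auto simp: lookup_single when_def)
    then show ?thesis by simp
  qed
  show "M = mon S + (M - mon S)"
    by (rule poly_mapping_eqI) (simp add: lookup_add lookup_minus le)
qed

lemma inj_on_var:
  assumes "\<And>x y. x \<in> S \<Longrightarrow> y \<in> S \<Longrightarrow> x - y < n"
  shows "inj_on var S"
proof (rule inj_onI)
  fix x y assume xy: "x \<in> S" "y \<in> S" and "var x = var y"
  then have "n dvd x - y" by (simp add: var_eq_iff mod_eq_dvd_iff)
  moreover have "\<bar>x - y\<bar> < n" using assms[OF xy] assms[OF xy(2,1)] by linarith
  ultimately show "x = y" using zdvd_imp_le[of n "\<bar>x - y\<bar>"] by (cases "x = y") auto
qed

lemma prod_shift_mod:
  fixes f :: "int \<Rightarrow> 'a::comm_monoid_mult"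
  assumes f: "\<And>x. f (x mod n) = f x"
  shows "(\<Prod>x\<in>{j mod n - int t..j mod n}. f x) = (\<Prod>x\<in>{j - int t..j}. f x)"
proof -
  define q where "q = j div n"
  have j: "j mod n = j - n * q" unfolding q_def by (simp add: minus_mult_div_eq_mod)
  show ?thesis unfolding j
  proof (rule prod.reindex_bij_witness[where i = "\<lambda>x. x - n * q" and j = "\<lambda>x. x + n * q"])
    show "f (x + n * q) = f x" for x using f[of "x + n * q"] f[of x] by simp
  qed auto
qed

lemma \<Lambda>_mod: "\<Lambda> (j mod n) = \<Lambda> j"
  unfolding \<Lambda>_def by (rule prod_shift_mod) (rule \<phi>_mod)

lemma \<omega>_mod: "\<omega> (j mod n) = \<omega> j"
proof -
  have "\<phi> (j mod n) * \<omega> (j mod n) = \<phi> j * \<omega> j"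
    using \<omega>_\<phi>_right[of j] \<omega>_\<phi>_right[of "j mod n"] \<Lambda>_mod[of j] by (simp add: mult.commute)
  then have "\<phi> j * \<omega> (j mod n) = \<phi> j * \<omega> j" by (simp add: \<phi>_mod)
  then show ?thesis unfolding \<phi>_def by (rule single_times_cancel) (rule \<sigma>_nonzero)
qed

lemma lookup_\<omega>_times_zero:
  assumes "Poly_Mapping.lookup M (var x) = 0" "x < i" "i \<le> x + int t"
  shows "Poly_Mapping.lookup (\<omega> i * p) M = 0"
proof (rule ccontr)
  assume "Poly_Mapping.lookup (\<omega> i * p) M \<noteq> 0"
  then have "M \<in> Poly_Mapping.keys (Poly_Mapping.single (mon {i - int t..<i}) (\<Prod>x\<in>{i - int t..<i}. \<sigma> x) * p)"
    by (simp add: in_keys_iff \<omega>_eq)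
  then obtain m where "M = mon {i - int t..<i} + m" using keys_single_times by blast
  moreover have "0 < Poly_Mapping.lookup (mon {i - int t..<i}) (var x)"
    using assms by (intro lookup_mon_pos) auto
  ultimately show False using assms(1) by (simp add: lookup_add)
qed

text \<open>The monomial \<open>M\<close> is not divisible by \<open>\<Lambda> j\<close>.\<close>

definition misses :: "('v \<Rightarrow>\<^sub>0 nat) \<Rightarrow> int \<Rightarrow> bool" where
  "misses M j \<longleftrightarrow> (\<exists>x\<in>{j - int t..j}. Poly_Mapping.lookup M (var x) = 0)"

lemma misses_mod: "misses M (j mod n) \<longleftrightarrow> misses M j"
proof -
  define q where "q = j div n"
  have j: "j mod n = j - n * q" unfolding q_def by (simp add: minus_mult_div_eq_mod)
  have v: "var (x + n * q) = var x" "var (x - n * q) = var x" for x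
    using mod_mult_self2[of x n "- q"] by (simp_all add: var_eq_iff)
  show ?thesis unfolding misses_def j
  proof
    assume "\<exists>x\<in>{j - n * q - int t..j - n * q}. Poly_Mapping.lookup M (var x) = 0"
    then obtain x where "x \<in> {j - n * q - int t..j - n * q}" "Poly_Mapping.lookup M (var x) = 0" by blast
    then show "\<exists>x\<in>{j - int t..j}. Poly_Mapping.lookup M (var x) = 0"
      by (intro bexI[of _ "x + n * q"]) (auto simp: v)
  next
    assume "\<exists>x\<in>{j - int t..j}. Poly_Mapping.lookup M (var x) = 0"
    then obtain x where "x \<in> {j - int t..j}" "Poly_Mapping.lookup M (var x) = 0" by blast
    then show "\<exists>x\<in>{j - n * q - int t..j - n * q}. Poly_Mapping.lookup M (var x) = 0"
      by (intro bexI[of _ "x - n * q"]) (auto simp: v)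
  qed
qed

lemma \<Lambda>_quotient:
  assumes "\<And>M. M \<in> Poly_Mapping.keys p \<Longrightarrow> \<not> misses M j"
  obtains q where "p = \<Lambda> j * q"
    "\<And>m. m \<in> Poly_Mapping.keys q \<Longrightarrow> mon {j - int t..j} + m \<in> Poly_Mapping.keys p"
proof -
  have "\<exists>m. M = mon {j - int t..j} + m" if "M \<in> Poly_Mapping.keys p" for M
  proof (rule mon_dvd)
    show "inj_on var {j - int t..j}" by (rule inj_on_var) (auto simp: n_def)
    show "0 < Poly_Mapping.lookup M (var x)" if "x \<in> {j - int t..j}" for x
      using assms[OF \<open>M \<in> Poly_Mapping.keys p\<close>] that by (auto simp: misses_def)
  qed simp
  then show thesis
    by (rule single_times_quotient[where s = "\<Prod>x\<in>{j - int t..j}. \<sigma> x"])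
      (use that in \<open>auto simp: \<Lambda>_eq\<close>)
qed

text \<open>Two gaps in the support of \<open>M\<close> force the terms in one of the two arcs between \<open>j\<close> and \<open>k\<close>
  to vanish at \<open>M\<close>, and all terms add up to zero.\<close>

lemma partial_sums_eq:
  assumes v: "\<And>j. v (j mod n) = v j" and sum: "(\<Sum>j\<in>{0..<n}. \<omega> j * v j) = 0"
    and jk: "0 \<le> j" "j \<le> k" "k < n" and miss: "misses M j" "misses M k"
  shows "Poly_Mapping.lookup (\<Sum>i\<in>{0..j}. \<omega> i * v i) M = Poly_Mapping.lookup (\<Sum>i\<in>{0..k}. \<omega> i * v i) M"
proof -
  let ?a = "\<lambda>i. Poly_Mapping.lookup (\<omega> i * v i) M"
  have a_mod: "?a (i mod n) = ?a i" for i by (simp add: v \<omega>_mod)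
  obtain x y where x: "x \<in> {j - int t..j}" "Poly_Mapping.lookup M (var x) = 0"
    and y: "y \<in> {k - int t..k}" "Poly_Mapping.lookup M (var y) = 0"
    using miss by (auto simp: misses_def)
  \<comment> \<open>A gap at \<open>x\<close> kills the \<open>t\<close> terms that follow it,
    because their windows contain \<open>x\<close>. If \<open>y\<close> is at most
    \<open>x + t\<close>, the runs after the two gaps cover the indices from \<open>j + 1\<close> to
    \<open>k\<close>; otherwise they cover those from \<open>k + 1\<close> around to
    \<open>j + n\<close>.\<close>
  have ax: "?a i = 0" if "x < i" "i \<le> x + int t" for i using lookup_\<omega>_times_zero[OF x(2)] that by simp
  have ay: "?a i = 0" if "y < i" "i \<le> y + int t" for i using lookup_\<omega>_times_zero[OF y(2)] that by simp
  show ?thesis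
  proof (cases "y \<le> x + int t")
    case True
    have "?a i = 0" if "j < i" "i \<le> k" for i
      using that True x(1) y(1) ax[of i] ay[of i] by (cases "i \<le> x + int t") auto
    then have "(\<Sum>i\<in>{0..k}. ?a i) = (\<Sum>i\<in>{0..j}. ?a i)"
      by (intro sum.mono_neutral_right) (use jk in auto)
    then show ?thesis by (simp add: lookup_sum)
  next
    case False
    have wrap: "?a i = 0" if "k < i" "i \<le> j + n" for i
    proof (cases "i \<le> y + int t")
      case True
      then show ?thesis using that y(1) ay[of i] by auto
    next
      case gt: False
      have "?a (i - n) = 0"
        by (rule ax) (use gt False that x(1) in \<open>auto simp: n_def\<close>)
      moreover have "?a (i - n) = ?a i" using a_mod[of "i - n"] a_mod[of i] by simp
      ultimately show ?thesis by simp
    qed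
    have low: "?a i = 0" if "0 \<le> i" "i \<le> j" for i
      using wrap[of "i + n"] a_mod[of "i + n"] a_mod[of i] that jk by simp
    have "(\<Sum>i\<in>{0..j}. ?a i) = 0" by (rule sum.neutral) (use low in auto)
    moreover have "(\<Sum>i\<in>{0..k}. ?a i) = (\<Sum>i\<in>{0..<n}. ?a i)"
      by (rule sum.mono_neutral_left) (use wrap jk in auto)
    moreover have "\<dots> = 0" using sum by (simp flip: lookup_sum)
    ultimately show ?thesis by (simp add: lookup_sum)
  qed
qed

text \<open>With \<open>\<beta> j = \<Lambda> j * z j\<close> the equation to solve is
  \<open>\<beta> (j - 1) - \<beta> j = \<omega> j * v j\<close>. The negated partial sums solve it
  up to a constant of summation, which is fixed monomial by monomial so that
  \<open>\<Lambda> j\<close> divides \<open>\<beta> j\<close>. The last conclusion is what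
  transports variables, order and degree from \<open>v\<close> to \<open>z\<close>.\<close>

theorem cycle_exact_middle:
  assumes v: "\<And>j. v (j mod n) = v j" and sum: "(\<Sum>j\<in>{0..<n}. \<omega> j * v j) = 0"
  obtains z where "\<And>j. z (j mod n) = z j"
    "\<And>j. v j = \<phi> (j - 1 - int t) * z (j - 1) - \<phi> j * z j"
    "\<And>j m. m \<in> Poly_Mapping.keys (z j) \<Longrightarrow>
       \<exists>i. \<exists>m'\<in>Poly_Mapping.keys (v i). mon {j - int t..j} + m = mon {i - int t..<i} + m'"
proof -
  define B where "B j = (\<Sum>i\<in>{0..j}. \<omega> i * v i)" for j
  \<comment> \<open>If \<open>\<Lambda> k\<close> does not divide \<open>M\<close>, the constant
    must have the coefficient of \<open>B k\<close> at \<open>M\<close>; by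
    \<open>partial_sums_eq\<close> all such \<open>k\<close> agree. If there is no such
    \<open>k\<close>, any value is admissible, and the default 0 only keeps
    \<open>\<kappa> M\<close> in the range of the sum in \<open>\<beta>\<close>.\<close>
  define \<kappa> where "\<kappa> M = (if \<exists>k\<in>{0..<n}. misses M k then SOME k. k \<in> {0..<n} \<and> misses M k else 0)" for M
  have \<kappa>: "\<kappa> M \<in> {0..<n} \<and> misses M (\<kappa> M)" if "\<exists>k\<in>{0..<n}. misses M k" for M
    unfolding \<kappa>_def if_P[OF that] using someI_ex[OF that[unfolded Bex_def]] .
  have \<kappa>_range: "\<kappa> M \<in> {0..<n}" for M
    using \<kappa>[of M] n_pos by (cases "\<exists>k\<in>{0..<n}. misses M k") (auto simp: \<kappa>_def)
  define \<beta> where "\<beta> j = (\<Sum>k\<in>{0..<n}. poly_filter (\<lambda>M. \<kappa> M = k) (B k)) - B (j mod n)" for j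
  have \<beta>_lookup: "Poly_Mapping.lookup (\<beta> j) M = Poly_Mapping.lookup (B (\<kappa> M)) M - Poly_Mapping.lookup (B (j mod n)) M" for j M
    using \<kappa>_range[of M] by (simp add: \<beta>_def lookup_minus lookup_sum)
  have \<beta>_keys: "\<not> misses M j" if "M \<in> Poly_Mapping.keys (\<beta> j)" for M j
  proof
    assume "misses M j"
    then have m: "misses M (j mod n)" by (simp add: misses_mod)
    have r: "j mod n \<in> {0..<n}" using n_pos by simp
    from \<kappa>[of M] m r have k: "\<kappa> M \<in> {0..<n}" "misses M (\<kappa> M)" by blast+
    have "Poly_Mapping.lookup (B (\<kappa> M)) M = Poly_Mapping.lookup (B (j mod n)) M"
    proof (cases "\<kappa> M \<le> j mod n")
      case True
      show ?thesis unfolding B_def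
        by (rule partial_sums_eq[OF v sum _ True _ k(2) m]) (use k(1) r in simp_all)
    next
      case False
      then have le: "j mod n \<le> \<kappa> M" by simp
      show ?thesis unfolding B_def
        by (rule partial_sums_eq[OF v sum _ le _ m k(2), symmetric]) (use k(1) r in simp_all)
    qed
    then show False using that by (simp add: in_keys_iff \<beta>_lookup)
  qed
  have "\<exists>q. \<beta> j = \<Lambda> j * q \<and> (\<forall>m\<in>Poly_Mapping.keys q. mon {j - int t..j} + m \<in> Poly_Mapping.keys (\<beta> j))" for j
    using \<Lambda>_quotient[of "\<beta> j" j] \<beta>_keys by metis
  then obtain z where z: "\<And>j. \<beta> j = \<Lambda> j * z j"
    and z_keys: "\<And>j m. m \<in> Poly_Mapping.keys (z j) \<Longrightarrow> mon {j - int t..j} + m \<in> Poly_Mapping.keys (\<beta> j)"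
    by metis
  have \<beta>_mod: "\<beta> (j mod n) = \<beta> j" for j by (simp add: \<beta>_def)
  have diff: "\<omega> j * v j = \<beta> (j - 1) - \<beta> j" for j
  proof -
    define r where "r = j mod n"
    have r: "0 \<le> r" "r < n" using n_pos by (auto simp: r_def)
    have "\<omega> j * v j = B r - B ((j - 1) mod n)"
    proof (cases "r = 0")
      \<comment> \<open>Here the cycle closes: the preceding partial sum is the full sum, which
        vanishes.\<close>
      case True
      then have "(j - 1) mod n = (- 1) mod n" unfolding r_def by (metis mod_diff_left_eq diff_0)
      also have "\<dots> = n - 1" using n_pos by (simp add: zmod_minus1)
      finally have "B ((j - 1) mod n) = (\<Sum>j\<in>{0..<n}. \<omega> j * v j)"
        unfolding B_def by (intro sum.cong) auto
      then have "B ((j - 1) mod n) = 0" using sum by simp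
      moreover have "B r = \<omega> r * v r" using True by (simp add: B_def)
      ultimately show ?thesis by (simp add: r_def v \<omega>_mod)
    next
      case False
      have "(j - 1) mod n = (r - 1) mod n" unfolding r_def by (simp add: mod_diff_left_eq)
      also have "\<dots> = r - 1" using False r by (intro mod_pos_pos_trivial) auto
      finally have e: "(j - 1) mod n = r - 1" .
      have "{0..r} = insert r {0..r - 1}" using r by auto
      then have "B r = \<omega> r * v r + B (r - 1)" by (simp add: B_def)
      then show ?thesis unfolding e by (simp add: r_def v \<omega>_mod)
    qed
    then show ?thesis by (simp add: \<beta>_def r_def)
  qed
  show thesis
  proof
    show "z (j mod n) = z j" for j
      using z[of j] z[of "j mod n"] \<beta>_mod[of j] \<Lambda>_mod[of j] \<Lambda>_cancel by metis
    show "v j = \<phi> (j - 1 - int t) * z (j - 1) - \<phi> j * z j" for j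
    proof (rule \<omega>_cancel)
      have "\<omega> j * v j = \<omega> j * \<phi> (j - 1 - int t) * z (j - 1) - \<omega> j * \<phi> j * z j"
        unfolding \<omega>_\<phi>_left \<omega>_\<phi>_right diff z ..
      then show "\<omega> j * v j = \<omega> j * (\<phi> (j - 1 - int t) * z (j - 1) - \<phi> j * z j)"
        by (simp add: algebra_simps)
    qed
    fix j m assume m: "m \<in> Poly_Mapping.keys (z j)"
    let ?M = "mon {j - int t..j} + m"
    have "Poly_Mapping.lookup (\<beta> j) ?M \<noteq> 0" using z_keys[OF m] by (simp add: in_keys_iff)
    then have "\<exists>k. Poly_Mapping.lookup (B k) ?M \<noteq> 0" unfolding \<beta>_lookup by (metis diff_self)
    then obtain k where "(\<Sum>i\<in>{0..k}. Poly_Mapping.lookup (\<omega> i * v i) ?M) \<noteq> 0"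
      by (auto simp: B_def lookup_sum)
    then obtain i where "Poly_Mapping.lookup (\<omega> i * v i) ?M \<noteq> 0" by (meson sum.neutral)
    then have "?M \<in> Poly_Mapping.keys (Poly_Mapping.single (mon {i - int t..<i}) (\<Prod>x\<in>{i - int t..<i}. \<sigma> x) * v i)"
      by (simp add: in_keys_iff \<omega>_eq)
    from keys_single_times[OF this]
    show "\<exists>i. \<exists>m'\<in>Poly_Mapping.keys (v i). mon {j - int t..j} + m = mon {i - int t..<i} + m'" by blast
  qed
qed

text \<open>The two windows have \<open>t + 1\<close> and \<open>t\<close> edges and are adjacent,
  so together they go around the cycle exactly once.\<close>

lemma \<Lambda>_\<omega>: "\<Lambda> j * \<omega> (j + int t + 1) = (\<Prod>x\<in>{0..<n}. \<phi> x)"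
proof -
  have "\<Lambda> j * \<omega> (j + int t + 1) = (\<Prod>x\<in>{j - int t..j} \<union> {j + 1..<j + int t + 1}. \<phi> x)"
    unfolding \<Lambda>_def \<omega>_def by (subst prod.union_disjoint) (auto intro!: arg_cong2[where f = "(*)"] prod.cong)
  also have "{j - int t..j} \<union> {j + 1..<j + int t + 1} = {j - int t..j + int t}" by auto
  also have "(\<Prod>x\<in>{j - int t..j + int t}. \<phi> x) = (\<Prod>x\<in>{0..<n}. \<phi> x)"
  proof (rule prod.reindex_bij_witness[where j = "\<lambda>x. x mod n"
        and i = "\<lambda>x. (x - (j - int t)) mod n + (j - int t)"])
    fix x assume x: "x \<in> {j - int t..j + int t}"
    have "(x mod n - (j - int t)) mod n = (x - (j - int t)) mod n" by (rule mod_diff_left_eq)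
    also have "\<dots> = x - (j - int t)" using x by (intro mod_pos_pos_trivial) (auto simp: n_def)
    finally show "(x mod n - (j - int t)) mod n + (j - int t) = x" by simp
    show "x mod n \<in> {0..<n}" using n_pos by simp
    show "\<phi> (x mod n) = \<phi> x" by (rule \<phi>_mod)
  next
    fix x assume x: "x \<in> {0..<n}"
    show "((x - (j - int t)) mod n + (j - int t)) mod n = x"
      using x by (simp add: mod_add_left_eq)
    have "0 \<le> (x - (j - int t)) mod n" "(x - (j - int t)) mod n < n" using n_pos by auto
    then show "(x - (j - int t)) mod n + (j - int t) \<in> {j - int t..j + int t}" by (auto simp: n_def)
  qed
  finally show ?thesis .
qed

text \<open>Multiplied by \<open>\<omega> j\<close>, the relations say that
  \<open>\<Lambda> j * z j\<close> is independent of \<open>j\<close>. The common value is divisible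
  by every \<open>\<Lambda> j\<close>, hence by each of the \<open>n\<close> distinct edge variables
  and by their product; cancelling \<open>\<Lambda> j\<close> leaves the complementary
  window.\<close>

theorem cycle_exact_left:
  assumes z: "\<And>j. z (j mod n) = z j" and rel: "\<And>j. \<phi> (j - 1 - int t) * z (j - 1) = \<phi> j * z j"
  obtains c where "\<And>j. z j = \<omega> (j + int t + 1) * c"
    "\<And>m. m \<in> Poly_Mapping.keys c \<Longrightarrow> mon {1..<int t + 1} + m \<in> Poly_Mapping.keys (z 0)"
proof -
  define \<beta> where "\<beta> j = \<Lambda> j * z j" for j
  have step: "\<beta> (j - 1) = \<beta> j" for j
    unfolding \<beta>_def \<omega>_\<phi>_left[of j, symmetric] \<omega>_\<phi>_right[of j, symmetric] using rel[of j] by (simp add: mult.assoc)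
  have const: "\<beta> j = \<beta> 0" for j
  proof (induction j rule: int_induct[where k = 0])
    case (step1 i)
    then show ?case using step[of "i + 1"] by simp
  next
    case (step2 i)
    then show ?case using step[of i] by simp
  qed simp
  let ?\<Phi> = "mon {0..<n}" and ?s = "\<Prod>x\<in>{0..<n}. \<sigma> x"
  have "\<exists>m. M = ?\<Phi> + m" if M: "M \<in> Poly_Mapping.keys (\<beta> 0)" for M
  proof (rule mon_dvd)
    show "inj_on var {0..<n}" by (rule inj_on_var) auto
    fix x assume "x \<in> {0..<n}"
    have "M \<in> Poly_Mapping.keys (Poly_Mapping.single (mon {x - int t..x}) (\<Prod>x\<in>{x - int t..x}. \<sigma> x) * z x)"
      using M const[of x] by (simp add: \<beta>_def \<Lambda>_eq)
    then obtain m where "M = mon {x - int t..x} + m" using keys_single_times by blast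
    then show "0 < Poly_Mapping.lookup M (var x)"
      using lookup_mon_pos[of "{x - int t..x}" x] by (simp add: lookup_add)
  qed simp
  then obtain c where c: "\<beta> 0 = Poly_Mapping.single ?\<Phi> ?s * c"
    by (rule single_times_quotient[where s = ?s]) auto
  have zc: "z j = \<omega> (j + int t + 1) * c" for j
  proof (rule \<Lambda>_cancel)
    show "\<Lambda> j * z j = \<Lambda> j * (\<omega> (j + int t + 1) * c)"
      unfolding mult.assoc[symmetric] \<Lambda>_\<omega> using const[of j] c by (simp add: \<beta>_def prod_\<phi>)
  qed
  have "mon {1..<int t + 1} + m \<in> Poly_Mapping.keys (z 0)" if "m \<in> Poly_Mapping.keys c" for m
    using that zc[of 0] by (simp add: \<omega>_eq in_keys_iff lookup_single_times)
  with zc show thesis using that by blast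
qed

end

section \<open>The leading part of the generic complex\<close>

definition weighted_degree :: "('v \<Rightarrow> nat) \<Rightarrow> ('v \<Rightarrow>\<^sub>0 nat) \<Rightarrow> nat" where
  "weighted_degree w m = (\<Sum>v\<in>Poly_Mapping.keys m. w v * Poly_Mapping.lookup m v)"

lemma weighted_degree_eq:
  assumes "finite S" "Poly_Mapping.keys m \<subseteq> S"
  shows "weighted_degree w m = (\<Sum>v\<in>S. w v * Poly_Mapping.lookup m v)"
  unfolding weighted_degree_def
  by (rule sum.mono_neutral_left) (use assms in \<open>auto simp: in_keys_iff\<close>)

lemma keys_add_nat: "Poly_Mapping.keys (m + m' :: 'v \<Rightarrow>\<^sub>0 nat) = Poly_Mapping.keys m \<union> Poly_Mapping.keys m'"
  by (auto simp: in_keys_iff lookup_add)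

lemma weighted_degree_add [simp]: "weighted_degree w (m + m') = weighted_degree w m + weighted_degree w m'"
proof -
  have fin: "finite (Poly_Mapping.keys (m + m'))" by simp
  show ?thesis
    using weighted_degree_eq[OF fin, of m w] weighted_degree_eq[OF fin, of m' w]
      weighted_degree_eq[OF fin, of "m + m'" w]
    by (simp add: keys_add_nat lookup_add ring_distribs sum.distrib)
qed

lemma weighted_degree_0 [simp]: "weighted_degree w 0 = 0"
  by (simp add: weighted_degree_def)

lemma weighted_degree_single [simp]: "weighted_degree w (Poly_Mapping.single v k) = w v * k"
  by (simp add: weighted_degree_def)

lemma weighted_degree_sum [simp]: "weighted_degree w (\<Sum>x\<in>S. f x) = (\<Sum>x\<in>S. weighted_degree w (f x))"
  by (induction S rule: infinite_finite_induct) auto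

lemma mdeg_eq: "mdeg = weighted_degree (\<lambda>_. 1)"
  by (rule ext) (simp add: mdeg_def weighted_degree_def)

lemma mdeg_add [simp]: "mdeg (m + m') = mdeg m + mdeg m'"
  by (simp add: mdeg_eq)

text \<open>One set of closure rules thus serves the variables that occur, the total degree, the
  off-cycle order and all their conjunctions.\<close>

definition keys_in :: "('a \<Rightarrow> bool) \<Rightarrow> ('a \<Rightarrow>\<^sub>0 'b::zero) set" where
  "keys_in P = {p. \<forall>m\<in>Poly_Mapping.keys p. P m}"

lemma keys_in_mono: "\<lbrakk>p \<in> keys_in P; \<And>m. P m \<Longrightarrow> Q m\<rbrakk> \<Longrightarrow> p \<in> keys_in Q"
  by (auto simp: keys_in_def)

lemma keys_in_0 [simp]: "0 \<in> keys_in P"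
  by (simp add: keys_in_def)

lemma keys_in_add: "\<lbrakk>p \<in> keys_in P; q \<in> keys_in P\<rbrakk> \<Longrightarrow> p + q \<in> keys_in P"
  using Poly_Mapping.keys_add[of p q] by (auto simp: keys_in_def)

lemma keys_in_uminus: "p \<in> keys_in P \<Longrightarrow> - p \<in> keys_in P" for p :: "'a \<Rightarrow>\<^sub>0 'b::ab_group_add"
  by (simp add: keys_in_def in_keys_iff)

lemma keys_in_diff: "\<lbrakk>p \<in> keys_in P; q \<in> keys_in P\<rbrakk> \<Longrightarrow> p - q \<in> keys_in P" for p q :: "'a \<Rightarrow>\<^sub>0 'b::ab_group_add"
  using keys_in_add[of p P "- q"] keys_in_uminus[of q P] by simp

lemma keys_in_sum: "(\<And>x. x \<in> S \<Longrightarrow> f x \<in> keys_in P) \<Longrightarrow> (\<Sum>x\<in>S. f x) \<in> keys_in P"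
  by (induction S rule: infinite_finite_induct) (auto intro: keys_in_add)

lemma keys_in_mult:
  fixes p q :: "('a::monoid_add) \<Rightarrow>\<^sub>0 ('b::semiring_0)"
  assumes "p \<in> keys_in P" "q \<in> keys_in Q" "\<And>m m'. P m \<Longrightarrow> Q m' \<Longrightarrow> R (m + m')"
  shows "p * q \<in> keys_in R"
  using keys_mult[of p q] assms by (fastforce simp: keys_in_def)

lemma keys_in_1: "P 0 \<Longrightarrow> (1 :: ('a::monoid_add) \<Rightarrow>\<^sub>0 ('b::zero_neq_one)) \<in> keys_in P"
  by (simp add: keys_in_def)

lemma minus_one_power_mult_keys_in:
  fixes p :: "('a::monoid_add) \<Rightarrow>\<^sub>0 ('b::ring_1)"
  shows "p \<in> keys_in P \<Longrightarrow> (-1) ^ k * p \<in> keys_in P"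
  by (cases "even k") (auto intro: keys_in_uminus)

abbreviation polys_over :: "'v set \<Rightarrow> ('v, 'k::field) mpoly set" where
  "polys_over V \<equiv> keys_in (\<lambda>m. Poly_Mapping.keys m \<subseteq> V)"

lemma polys_over_mult: "\<lbrakk>p \<in> polys_over V; q \<in> polys_over V\<rbrakk> \<Longrightarrow> p * q \<in> polys_over V"
  by (erule (1) keys_in_mult) (auto simp: keys_add_nat)

locale generic_skew =
  fixes t :: nat and A :: "nat \<Rightarrow> nat \<Rightarrow> (nat \<times> nat, 'k::field) mpoly"
  assumes t_pos: "t \<ge> 1"
    and A_def: "A i j = (if i < j then indet (i, j) else if j < i then - indet (j, i) else 0)"
begin

definition n :: nat where "n = 2 * t + 1"

definition q :: "nat \<Rightarrow> (nat \<times> nat, 'k) mpoly" where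
  "q k = (-1) ^ k * pf A (drop_nth k [0..<n])"

lemma alternating: "alternating_form A"
  by (auto simp: alternating_form_def A_def)

lemma row_relation: "i < n \<Longrightarrow> (\<Sum>j<n. A i j * q j) = 0"
proof -
  assume "i < n"
  then have "pf A (i # [0..<n]) = 0" by (intro pf_repeated alternating) simp
  then show ?thesis by (simp add: pf.simps(2) q_def mult_ac)
qed

lemma column_relation: "j < n \<Longrightarrow> (\<Sum>i<n. q i * A i j) = 0"
proof -
  assume "j < n"
  have "A i j = - A j i" for i by (auto simp: A_def)
  then have "(\<Sum>i<n. q i * A i j) = - (\<Sum>i<n. A j i * q i)"
    by (simp add: sum_negf mult.commute)
  then show ?thesis using row_relation[OF \<open>j < n\<close>] by simp
qed

text \<open>Moving the \<open>k\<close> indices before the gap to the end costs the sign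
  \<open>(-1) ^ (k * (2 * t - k))\<close>, which cancels the sign in \<open>q k\<close>. In this
  form all \<open>q k\<close> look alike under rotation of the cycle.\<close>

lemma q_rotated:
  assumes "k < n"
  shows "q k = pf A (map (\<lambda>l. (k + 1 + l) mod n) [0..<2 * t])"
proof -
  have "map (\<lambda>l. (k + 1 + l) mod n) [0..<2 * t] = [Suc k..<n] @ [0..<k]"
  proof (rule nth_equalityI)
    fix l assume "l < length (map (\<lambda>l. (k + 1 + l) mod n) [0..<2 * t])"
    then have l: "l < 2 * t" by simp
    show "map (\<lambda>l. (k + 1 + l) mod n) [0..<2 * t] ! l = ([Suc k..<n] @ [0..<k]) ! l"
    proof (cases "k + 1 + l < n")
      case True
      then show ?thesis using l by (auto simp: nth_append simp del: upt_Suc)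
    next
      case False
      then have "(k + 1 + l) mod n = k + 1 + l - n" using l assms n_def by (subst le_mod_geq) auto
      then show ?thesis using False l assms n_def by (auto simp: nth_append simp del: upt_Suc)
    qed
  qed (use assms n_def in simp)
  moreover have "drop_nth k [0..<n] = [0..<k] @ [Suc k..<n]"
    using assms by (simp add: drop_nth_def take_upt drop_upt)
  moreover have "pf A ([0..<k] @ [Suc k..<n]) = (-1) ^ (k * (n - Suc k)) * pf A ([Suc k..<n] @ [0..<k])"
    using pf_swap_blocks[OF alternating, of "[]" "[0..<k]" "[Suc k..<n]"] by (simp del: upt_Suc)
  moreover have "even (k + k * (n - Suc k))" using assms by (auto simp: n_def)
  then have "(-1 :: (nat \<times> nat, 'k) mpoly) ^ k * (-1) ^ (k * (n - Suc k)) = 1"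
    unfolding power_add[symmetric] by simp
  ultimately show ?thesis unfolding q_def by (simp add: mult.assoc[symmetric])
qed

section \<open>The generic matrix read along the cycle\<close>

definition edge :: "int \<Rightarrow> nat \<times> nat" where
  "edge i = (if i mod int n = int n - 1 then (0, n - 1) else (nat (i mod int n), nat (i mod int n) + 1))"

definition var :: "int \<Rightarrow> nat \<times> nat" where
  "var x = edge (2 * x)"

text \<open>The closing edge runs from \<open>n - 1\<close> to 0, against the order of the indices,
  so its matrix entry is minus an indeterminate.\<close>

definition \<sigma> :: "int \<Rightarrow> 'k" where
  "\<sigma> x = (if 2 * x mod int n = int n - 1 then -1 else 1)"

definition entry :: "int \<Rightarrow> int \<Rightarrow> (nat \<times> nat, 'k) mpoly" where
  "entry i j = A (nat (i mod int n)) (nat (j mod int n))"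

lemma n_gt: "int n > 2"
  using t_pos by (simp add: n_def)

lemma edge_eq_iff: "edge x = edge y \<longleftrightarrow> x mod int n = y mod int n"
  using n_gt pos_mod_sign[of "int n" x] pos_mod_sign[of "int n" y]
  by (auto simp: edge_def nat_eq_iff)

lemma double_mod_eq_iff: "2 * x mod int n = 2 * y mod int n \<longleftrightarrow> x mod int n = y mod int n"
proof -
  have "coprime (int n) 2" by (simp add: n_def)
  then have "int n dvd 2 * (x - y) \<longleftrightarrow> int n dvd x - y" by (rule coprime_dvd_mult_right_iff)
  then show ?thesis by (simp only: mod_eq_dvd_iff right_diff_distrib)
qed

sublocale edge_cycle t "int n" var \<sigma>
proof
  show "int n = 2 * int t + 1" by (simp add: n_def)
  show "var x = var y \<longleftrightarrow> x mod int n = y mod int n" for x y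
    by (simp add: var_def edge_eq_iff double_mod_eq_iff)
  show "\<sigma> (x mod int n) = \<sigma> x" for x
    by (simp add: \<sigma>_def mod_mult_right_eq)
qed (simp add: \<sigma>_def)

lemma entry_mod [simp]: "entry (i mod int n) j = entry i j" "entry i (j mod int n) = entry i j"
  by (simp_all add: entry_def)

lemma entry_swap: "entry i j = - entry j i"
  by (auto simp: entry_def A_def)

lemma entry_edge: "entry (2 * x) (2 * x + 1) = \<phi> x"
proof -
  define i where "i = 2 * x mod int n"
  have i: "0 \<le> i" "i < int n" using n_gt by (auto simp: i_def)
  have next_i: "(2 * x + 1) mod int n = (i + 1) mod int n" by (simp add: i_def mod_add_left_eq)
  show ?thesis
  proof (cases "i = int n - 1")
    case True
    then have "(i + 1) mod int n = 0" by simp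
    then show ?thesis using True n_gt
      by (simp add: entry_def next_i i_def[symmetric] \<phi>_def var_def edge_def \<sigma>_def A_def indet_def nat_diff_distrib single_uminus)
  next
    case False
    then have "(i + 1) mod int n = i + 1" using i by (intro mod_pos_pos_trivial) auto
    then show ?thesis using False i
      by (simp add: entry_def next_i i_def[symmetric] \<phi>_def var_def edge_def \<sigma>_def A_def indet_def nat_add_distrib)
  qed
qed

text \<open>The edge entering the vertex \<open>2 * x\<close> starts at \<open>2 * x - 1\<close>,
  which is congruent to twice \<open>x - 1 - t\<close> modulo \<open>n\<close>.\<close>

lemma entry_edge_back: "entry (2 * x - 1) (2 * x) = \<phi> (x - 1 - int t)"
proof -
  have "2 * (x - 1 - int t) = (2 * x - 1) + int n * (-1)" "2 * (x - 1 - int t) + 1 = 2 * x + int n * (-1)"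
    by (auto simp: n_def)
  then have "(2 * (x - 1 - int t)) mod int n = (2 * x - 1) mod int n"
    "(2 * (x - 1 - int t) + 1) mod int n = 2 * x mod int n"
    by (metis mod_mult_self2)+
  then show ?thesis unfolding entry_edge[symmetric] by (simp add: entry_def)
qed

text \<open>At order zero in the entries off the cycle, the complex becomes the one of \<open>edge_cycle\<close>.\<close>

definition off_cycle_degree :: "(nat \<times> nat \<Rightarrow>\<^sub>0 nat) \<Rightarrow> nat" where
  "off_cycle_degree = weighted_degree (\<lambda>v. if v \<in> range edge then 0 else 1)"

lemma off_cycle_degree_add [simp]: "off_cycle_degree (m + m') = off_cycle_degree m + off_cycle_degree m'"
  by (simp add: off_cycle_degree_def)

lemma off_cycle_degree_le: "off_cycle_degree m \<le> mdeg m"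
  unfolding off_cycle_degree_def mdeg_def weighted_degree_def by (intro sum_mono) auto

lemma off_cycle_degree_mon [simp]: "off_cycle_degree (mon S) = 0"
  by (simp add: off_cycle_degree_def mon_def var_def)

lemma mdeg_mon: "mdeg (mon S) = card S"
  by (simp add: mdeg_eq mon_def)

lemma edge_in_skew_vars: "edge i \<in> skew_vars n"
proof -
  have "0 \<le> i mod int n" "i mod int n < int n" using n_gt by auto
  then have "nat (i mod int n) + 1 < n" if "i mod int n \<noteq> int n - 1" using that by linarith
  then show ?thesis using n_gt by (auto simp: edge_def skew_vars_def)
qed

lemma keys_mon: "Poly_Mapping.keys (mon S) \<subseteq> skew_vars n"
  unfolding mon_def
  by (induction S rule: infinite_finite_induct) (auto simp: keys_add_nat var_def edge_in_skew_vars split: if_splits)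

abbreviation order_ge :: "nat \<Rightarrow> (nat \<times> nat, 'k) mpoly set" where
  "order_ge k \<equiv> keys_in (\<lambda>m. k \<le> off_cycle_degree m)"

abbreviation pure :: "nat \<Rightarrow> (nat \<times> nat, 'k) mpoly set" where
  "pure k \<equiv> keys_in (\<lambda>m. off_cycle_degree m = k)"

text \<open>This extracts relations between leading parts: the leading expression differs from a
  vanishing one by terms of higher order only.\<close>

lemma pure_order_ge_Suc: "\<lbrakk>p \<in> pure k; p \<in> order_ge (Suc k)\<rbrakk> \<Longrightarrow> p = 0"
  by (auto simp: keys_in_def keys_eq_empty[symmetric] simp del: keys_eq_empty)

lemma order_ge_mult: "\<lbrakk>a \<in> order_ge k; b \<in> order_ge l\<rbrakk> \<Longrightarrow> a * b \<in> order_ge (k + l)"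
  by (erule (1) keys_in_mult) auto

lemma order_ge_mult_right: "a \<in> order_ge k \<Longrightarrow> a * b \<in> order_ge k"
  by (erule keys_in_mult[where Q = "\<lambda>_. True"]) (auto simp: keys_in_def)

lemma order_ge_mult_left: "b \<in> order_ge k \<Longrightarrow> a * b \<in> order_ge k"
  using order_ge_mult_right[of b k a] by (simp add: mult.commute)

lemma pure_mult: "\<lbrakk>a \<in> pure k; b \<in> pure l\<rbrakk> \<Longrightarrow> a * b \<in> pure (k + l)"
  by (erule (1) keys_in_mult) auto

lemma pure_imp_order_ge: "p \<in> pure k \<Longrightarrow> p \<in> order_ge k"
  by (auto simp: keys_in_def)

lemma \<phi>_pure: "\<phi> x \<in> pure 0"
  by (simp add: \<phi>_def keys_in_def off_cycle_degree_def var_def)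

lemma \<omega>_pure: "\<omega> j \<in> pure 0"
  by (simp add: \<omega>_eq keys_in_def)

lemma filter_remainder:
  assumes "p \<in> order_ge k"
  shows "p - poly_filter (\<lambda>m. off_cycle_degree m = k) p \<in> order_ge (Suc k)"
  unfolding keys_in_def
proof (intro CollectI ballI)
  fix m assume "m \<in> Poly_Mapping.keys (p - poly_filter (\<lambda>m. off_cycle_degree m = k) p)"
  then have "off_cycle_degree m \<noteq> k" "m \<in> Poly_Mapping.keys p"
    by (auto simp: in_keys_iff lookup_minus split: if_splits)
  then show "Suc k \<le> off_cycle_degree m" using assms by (force simp: keys_in_def)
qed

lemma entry_order_ge:
  assumes "(j - i) mod int n \<noteq> 1" "(j - i) mod int n \<noteq> int n - 1"
  shows "entry i j \<in> order_ge 1"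
proof -
  define a b where "a = nat (i mod int n)" and "b = nat (j mod int n)"
  have ab: "int a = i mod int n" "int b = j mod int n" using n_gt by (auto simp: a_def b_def)
  have lt: "a < n" "b < n" using n_gt by (simp_all add: a_def b_def nat_less_iff)
  have diff: "(int b - int a) mod int n = (j - i) mod int n" unfolding ab by (rule mod_diff_eq)
  have off: "(x, y) \<notin> range edge" if "x < y" "y < n" "(int y - int x) mod int n \<noteq> 1" "(int y - int x) mod int n \<noteq> int n - 1" for x y
  proof
    assume "(x, y) \<in> range edge"
    then have "y = x + 1 \<or> x = 0 \<and> y = n - 1" by (auto simp: edge_def split: if_splits)
    then show False using that n_gt by (auto simp: of_nat_diff)
  qed
  have swap: "(int a - int b) mod int n \<noteq> 1" "(int a - int b) mod int n \<noteq> int n - 1"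
  proof -
    have "int a - int b = - (int b - int a)" by simp
    then have "(int a - int b) mod int n = (- (int b - int a)) mod int n" by simp
    then have e: "(int a - int b) mod int n = (if (j - i) mod int n = 0 then 0 else int n - (j - i) mod int n)"
      unfolding zmod_zminus1_eq_if diff .
    show "(int a - int b) mod int n \<noteq> 1" "(int a - int b) mod int n \<noteq> int n - 1"
      unfolding e using assms n_gt by auto
  qed
  show ?thesis
    using off[of a b] off[of b a] lt diff assms swap
    by (auto simp: entry_def a_def[symmetric] b_def[symmetric] A_def indet_def keys_in_def off_cycle_degree_def)
qed

text \<open>In order zero the first index can only be matched with the second, as the other entries
  of its row have positive order; a path with two points fewer remains.\<close>

lemma pf_path:
  assumes "\<And>a b. \<lbrakk>a < b; b < 2 * m; b \<noteq> Suc a\<rbrakk> \<Longrightarrow> A (g a) (g b) \<in> order_ge 1"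
  shows "pf A (map g [0..<2 * m]) - (\<Prod>l<m. A (g (2 * l)) (g (2 * l + 1))) \<in> order_ge 1"
  using assms
proof (induction m arbitrary: g)
  case 0
  then show ?case by simp
next
  case (Suc m)
  let ?g = "\<lambda>l. g (Suc (Suc l))"
  let ?xs = "map ?g [0..<2 * m]"
  have list: "map g [0..<2 * Suc m] = g 0 # g 1 # ?xs"
    by (simp add: upt_conv_Cons map_Suc_upt[symmetric] del: upt_Suc)
  have IH: "pf A ?xs - (\<Prod>l<m. A (?g (2 * l)) (?g (2 * l + 1))) \<in> order_ge 1"
    by (rule Suc.IH, rule Suc.prems) auto
  have "pf_row A (g 0) [g 1] ?xs \<in> order_ge 1"
    unfolding pf_row_def
  proof (rule keys_in_sum)
    fix k assume "k \<in> {..<length ?xs}"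
    then have "A (g 0) (?xs ! k) \<in> order_ge 1" using Suc.prems[of 0 "Suc (Suc k)"] by simp
    then show "(- 1) ^ k * A (g 0) (?xs ! k) * pf A ([g 1] @ drop_nth k ?xs) \<in> order_ge 1"
      unfolding mult.assoc by (intro minus_one_power_mult_keys_in order_ge_mult_right)
  qed
  moreover have "A (g 0) (g 1) * (pf A ?xs - (\<Prod>l<m. A (?g (2 * l)) (?g (2 * l + 1)))) \<in> order_ge 1"
    by (rule order_ge_mult_left[OF IH])
  ultimately have "A (g 0) (g 1) * (pf A ?xs - (\<Prod>l<m. A (?g (2 * l)) (?g (2 * l + 1))))
      - pf_row A (g 0) [g 1] ?xs \<in> order_ge 1" by (rule keys_in_diff[rotated])
  then show ?case unfolding list
    by (simp add: pf_Cons[of A "g 0"] pf_row_Cons prod.lessThan_Suc_shift algebra_simps del: prod.lessThan_Suc)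
qed

definition vertex :: "int \<Rightarrow> nat" where
  "vertex j = nat (2 * j mod int n)"

lemma vertex_less: "vertex j < n"
  using n_gt by (simp add: vertex_def nat_less_iff)

lemma vertex_mod: "vertex (j mod int n) = vertex j"
  by (simp add: vertex_def mod_mult_right_eq)

lemma vertex_surj:
  assumes "i < n"
  shows "vertex (int i * (int t + 1)) = i"
proof -
  have "2 * (int i * (int t + 1)) = int i + int n * int i" by (simp add: n_def algebra_simps)
  then show ?thesis using assms by (simp add: vertex_def)
qed

lemma inj_on_vertex: "inj_on vertex {0..<int n}"
proof (rule inj_onI)
  fix x y assume xy: "x \<in> {0..<int n}" "y \<in> {0..<int n}" "vertex x = vertex y"
  then have "2 * x mod int n = 2 * y mod int n" using n_gt by (simp add: vertex_def nat_eq_iff)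
  then show "x = y" using xy by (simp add: double_mod_eq_iff)
qed

lemma bij_betw_vertex: "bij_betw vertex {0..<int n} {..<n}"
proof -
  have "vertex ` {0..<int n} \<subseteq> {..<n}" using vertex_less by auto
  moreover have "card (vertex ` {0..<int n}) = card {..<n}" using card_image[OF inj_on_vertex] by simp
  ultimately have "vertex ` {0..<int n} = {..<n}" by (intro card_subset_eq) auto
  then show ?thesis using inj_on_vertex by (simp add: bij_betw_def)
qed

lemma q_leading: "q (vertex j) - \<omega> j \<in> order_ge 1"
proof -
  let ?g = "\<lambda>l. (vertex j + 1 + l) mod n"
  have g: "A (?g a) (?g b) = entry (2 * j + 1 + int a) (2 * j + 1 + int b)" for a b
  proof -
    have "int (?g a) = (2 * j + 1 + int a) mod int n" for a
      using n_gt mod_add_left_eq[of "2 * j" "int n" "1 + int a"]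
      by (simp add: vertex_def zmod_int ac_simps)
    then have "?g a = nat ((2 * j + 1 + int a) mod int n)" for a by (metis nat_int)
    then show ?thesis by (simp add: entry_def)
  qed
  have "pf A (map ?g [0..<2 * t]) - (\<Prod>l<t. A (?g (2 * l)) (?g (2 * l + 1))) \<in> order_ge 1"
  proof (rule pf_path)
    fix a b assume ab: "a < b" "b < 2 * t" "b \<noteq> Suc a"
    \<comment> \<open>The difference lies between 2 and \<open>n - 2\<close>, so the closing edge of
      the cycle is excluded as well.\<close>
    have "(int b - int a) mod int n = int b - int a"
      using ab by (intro mod_pos_pos_trivial) (auto simp: n_def)
    then show "A (?g a) (?g b) \<in> order_ge 1" unfolding g
      by (intro entry_order_ge) (use ab in \<open>auto simp: n_def\<close>)
  qed
  moreover have "(\<Prod>l<t. A (?g (2 * l)) (?g (2 * l + 1))) = \<omega> j"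
  proof -
    have "A (?g (2 * l)) (?g (2 * l + 1)) = \<phi> (j - int t + int l)" for l
    proof -
      \<comment> \<open>Reduction by \<open>n\<close> turns the odd offset into the even number
        \<open>2 * (j - t + l)\<close>; hence the window of \<open>\<omega> j\<close> starts at
        \<open>j - t\<close>.\<close>
      have "2 * j + 1 + int (2 * l) = 2 * (j - int t + int l) + int n * 1"
        "2 * j + 1 + int (2 * l + 1) = 2 * (j - int t + int l) + 1 + int n * 1" by (auto simp: n_def)
      then show ?thesis unfolding g entry_edge[symmetric] entry_def by (metis mod_mult_self2)
    qed
    then have "(\<Prod>l<t. A (?g (2 * l)) (?g (2 * l + 1))) = (\<Prod>l<t. \<phi> (j - int t + int l))" by simp
    also have "\<dots> = \<omega> j" unfolding \<omega>_def
      by (rule prod.reindex_bij_witness[where i = "\<lambda>x. nat (x - (j - int t))" and j = "\<lambda>l. j - int t + int l"]) auto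
    finally show ?thesis .
  qed
  ultimately show ?thesis using q_rotated[OF vertex_less, of j] by simp
qed

text \<open>On the cycle the vertex 2j is joined to 2j + 1 and 2j - 1 only, so no other entry of its
  row has order zero. Indexing the unknowns by the vertices 2j + 1, with a sign, turns the leading
  part into the two-term expression of the cycle complex.\<close>

lemma row_leading:
  fixes u :: "nat \<Rightarrow> (nat \<times> nat, 'k) mpoly" and j :: int
  assumes u: "\<And>i. i < n \<Longrightarrow> u i \<in> order_ge k"
  defines "z \<equiv> \<lambda>j. - u (nat ((2 * j + 1) mod int n))"
  shows "(\<Sum>l<n. A (vertex j) l * u l) - (\<phi> (j - 1 - int t) * z (j - 1) - \<phi> j * z j) \<in> order_ge (Suc k)"
proof -
  let ?a = "nat ((2 * j + 1) mod int n)" and ?b = "nat ((2 * j - 1) mod int n)"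
  have ab: "?a < n" "?b < n" using n_gt by (auto simp: nat_less_iff)
  have "(2 * j + 1) mod int n \<noteq> (2 * j - 1) mod int n"
    using n_gt zdvd_imp_le[of "int n" 2] by (auto simp: mod_eq_dvd_iff)
  then have ne: "?a \<noteq> ?b" using n_gt by (simp add: nat_eq_iff)
  have "(\<Sum>l<n. A (vertex j) l * u l) = (\<Sum>l\<in>{..<n} - {?a, ?b}. A (vertex j) l * u l)
      + (\<Sum>l\<in>{?a, ?b}. A (vertex j) l * u l)"
    by (rule sum.subset_diff) (use ab in auto)
  moreover have "(\<Sum>l\<in>{?a, ?b}. A (vertex j) l * u l) = \<phi> (j - 1 - int t) * z (j - 1) - \<phi> j * z j"
  proof -
    have "A (vertex j) ?a = \<phi> j" unfolding entry_edge[symmetric] by (simp add: entry_def vertex_def)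
    moreover have "A (vertex j) ?b = - \<phi> (j - 1 - int t)"
      unfolding entry_edge_back[symmetric] using entry_swap[of "2 * j" "2 * j - 1"] by (simp add: entry_def vertex_def)
    moreover have "2 * (j - 1) + 1 = 2 * j - 1" by simp
    ultimately show ?thesis using ne by (simp add: z_def)
  qed
  moreover have "(\<Sum>l\<in>{..<n} - {?a, ?b}. A (vertex j) l * u l) \<in> order_ge (Suc k)"
  proof (rule keys_in_sum)
    fix l assume l: "l \<in> {..<n} - {?a, ?b}"
    have "(int l - 2 * j) mod int n \<noteq> 1"
    proof
      assume "(int l - 2 * j) mod int n = 1"
      then have "(int l - 2 * j) mod int n = 1 mod int n" using n_gt by simp
      then have "int l mod int n = (2 * j + 1) mod int n" by (simp add: mod_eq_dvd_iff algebra_simps)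
      then show False using l by auto
    qed
    moreover have "(int l - 2 * j) mod int n \<noteq> int n - 1"
    proof
      assume "(int l - 2 * j) mod int n = int n - 1"
      then have "(int l - 2 * j) mod int n = (-1) mod int n" using n_gt by (simp add: zmod_minus1)
      then have "int l mod int n = (2 * j - 1) mod int n" by (simp add: mod_eq_dvd_iff algebra_simps)
      then show False using l by auto
    qed
    ultimately have "entry (2 * j) (int l) \<in> order_ge 1" by (rule entry_order_ge)
    then have "A (vertex j) l \<in> order_ge 1" using l by (simp add: entry_def vertex_def)
    then show "A (vertex j) l * u l \<in> order_ge (Suc k)" using order_ge_mult[of _ 1 "u l" k] u l by simp
  qed
  ultimately show ?thesis by simp
qed

end

section \<open>Lifting exactness from the leading part\<close>

context generic_skew
begin

abbreviation carrier_polys :: "(nat \<times> nat, 'k) mpoly set" where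
  "carrier_polys \<equiv> polys_over (skew_vars n)"

abbreviation forms :: "nat \<Rightarrow> (nat \<times> nat, 'k) mpoly set" where
  "forms d \<equiv> keys_in (\<lambda>m. Poly_Mapping.keys m \<subseteq> skew_vars n \<and> mdeg m = d)"

lemma forms_mult: "\<lbrakk>a \<in> forms d; b \<in> forms e\<rbrakk> \<Longrightarrow> a * b \<in> forms (d + e)"
  by (erule (1) keys_in_mult) (auto simp: keys_add_nat)

lemma forms_imp_carrier: "a \<in> forms d \<Longrightarrow> a \<in> carrier_polys"
  by (erule keys_in_mono) auto

lemma A_form: "\<lbrakk>i < n; j < n\<rbrakk> \<Longrightarrow> A i j \<in> forms 1"
  by (auto simp: A_def indet_def keys_in_def skew_vars_def mdeg_eq)

lemma pf_form:
  "\<lbrakk>set xs \<subseteq> {..<n}; even (length xs)\<rbrakk> \<Longrightarrow> pf A xs \<in> forms (length xs div 2)"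
proof (induction "length xs" arbitrary: xs rule: less_induct)
  case less
  show ?case
  proof (cases xs)
    case Nil
    then show ?thesis by (simp add: keys_in_def mdeg_def)
  next
    case (Cons x ys)
    have "pf_row A x [] ys \<in> forms (length xs div 2)"
      unfolding pf_row_def
    proof (rule keys_in_sum)
      fix k assume "k \<in> {..<length ys}"
      then have k: "k < length ys" by simp
      have "pf A (drop_nth k ys) \<in> forms (length (drop_nth k ys) div 2)"
      proof (rule less.hyps)
        show "length (drop_nth k ys) < length xs" using k Cons by simp
        show "set (drop_nth k ys) \<subseteq> {..<n}" using less.prems(1) set_drop_nth[of k ys] Cons by auto
        show "even (length (drop_nth k ys))" using less.prems(2) k Cons by simp
      qed
      moreover have "ys ! k \<in> set ys" using k by simp
      then have "A x (ys ! k) \<in> forms 1" using less.prems(1) Cons by (intro A_form) auto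
      ultimately have "A x (ys ! k) * pf A (drop_nth k ys) \<in> forms (1 + length (drop_nth k ys) div 2)"
        by (rule forms_mult[rotated])
      moreover have "1 + length (drop_nth k ys) div 2 = length xs div 2"
        using k Cons less.prems(2) by (auto elim!: oddE)
      ultimately show "(- 1) ^ k * A x (ys ! k) * pf A ([] @ drop_nth k ys) \<in> forms (length xs div 2)"
        unfolding mult.assoc by (intro minus_one_power_mult_keys_in) simp
    qed
    then show ?thesis by (simp add: Cons pf_Cons)
  qed
qed

lemma q_form: "k < n \<Longrightarrow> q k \<in> forms t"
proof -
  assume k: "k < n"
  then have "length (drop_nth k [0..<n]) = 2 * t" by (simp add: n_def del: upt_Suc)
  then show ?thesis
    using pf_form[of "drop_nth k [0..<n]"] set_drop_nth[of k "[0..<n]"]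
    unfolding q_def by (intro minus_one_power_mult_keys_in) (simp add: atLeast0LessThan)
qed

abbreviation leading :: "nat \<Rightarrow> (nat \<times> nat, 'k) mpoly \<Rightarrow> (nat \<times> nat, 'k) mpoly" where
  "leading k \<equiv> poly_filter (\<lambda>m. off_cycle_degree m = k)"

lemma leading_pure: "leading k p \<in> pure k"
  by (simp add: keys_in_def)

text \<open>Multiplication by \<open>t + 1\<close> halves modulo \<open>n\<close>. It recovers
  \<open>j\<close> from the vertex 2j + 1 and thereby translates a solution \<open>z\<close> on the
  cycle back into a vector \<open>u\<close>.\<close>

lemma odd_vertex_mod: "(((2 * j + 1) mod int n - 1) * (int t + 1)) mod int n = j mod int n"
proof -
  define c where "c = (2 * j + 1) div int n"
  have e: "(2 * j + 1) mod int n = 2 * j + 1 - int n * c" unfolding c_def by (simp add: minus_mult_div_eq_mod)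
  have "(2 * j + 1 - int n * c - 1) * (int t + 1) = j + int n * (j - c * (int t + 1))"
    by (simp add: n_def algebra_simps)
  then show ?thesis unfolding e by simp
qed

text \<open>In order \<open>k\<close> the relation reads \<open>\<omega>\<close> times the leading
  parts of \<open>v\<close>, so the cycle complex supplies a preimage of the leading part. Its
  degree is smaller by one, which is exactly used up by the linear entries of the matrix, and the
  bound \<open>D\<close> survives the correction.\<close>

lemma middle_step:
  assumes v: "\<And>i. i < n \<Longrightarrow> v i \<in> keys_in (\<lambda>m. Poly_Mapping.keys m \<subseteq> skew_vars n \<and> k \<le> off_cycle_degree m \<and> mdeg m \<le> D)"
    and cycle: "(\<Sum>i<n. q i * v i) = 0"
  obtains u where
    "\<And>i. u i \<in> keys_in (\<lambda>m. Poly_Mapping.keys m \<subseteq> skew_vars n \<and> k \<le> off_cycle_degree m \<and> mdeg m + 1 \<le> D)"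
    "\<And>i. i < n \<Longrightarrow> v i - (\<Sum>l<n. A i l * u l) \<in> order_ge (Suc k)"
proof -
  define w where "w j = leading k (v (vertex j))" for j
  have v_order: "v (vertex j) \<in> order_ge k" for j
    using v[OF vertex_less] by (rule keys_in_mono) auto
  have w_mod: "w (j mod int n) = w j" for j by (simp add: w_def vertex_mod)
  have "(\<Sum>j\<in>{0..<int n}. \<omega> j * w j) = 0"
  proof (rule pure_order_ge_Suc)
    show "(\<Sum>j\<in>{0..<int n}. \<omega> j * w j) \<in> pure k"
      using pure_mult[OF \<omega>_pure leading_pure] by (intro keys_in_sum) (simp add: w_def)
    have "(\<Sum>j\<in>{0..<int n}. q (vertex j) * v (vertex j)) = 0"
      using sum.reindex_bij_betw[OF bij_betw_vertex, of "\<lambda>i. q i * v i"] cycle by simp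
    then have "(\<Sum>j\<in>{0..<int n}. \<omega> j * w j) = (\<Sum>j\<in>{0..<int n}. \<omega> j * w j - q (vertex j) * v (vertex j))"
      by (simp add: sum_subtractf)
    moreover have "\<omega> j * w j - q (vertex j) * v (vertex j) \<in> order_ge (Suc k)" for j
    proof -
      have "(q (vertex j) - \<omega> j) * v (vertex j) \<in> order_ge (1 + k)" by (rule order_ge_mult[OF q_leading v_order])
      moreover have "\<omega> j * (v (vertex j) - w j) \<in> order_ge (Suc k)"
        unfolding w_def by (rule order_ge_mult_left[OF filter_remainder[OF v_order]])
      ultimately have "- ((q (vertex j) - \<omega> j) * v (vertex j) + \<omega> j * (v (vertex j) - w j)) \<in> order_ge (Suc k)"
        by (intro keys_in_uminus keys_in_add) simp_all
      then show ?thesis by (simp add: algebra_simps)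
    qed
    ultimately show "(\<Sum>j\<in>{0..<int n}. \<omega> j * w j) \<in> order_ge (Suc k)" by (simp add: keys_in_sum)
  qed
  from cycle_exact_middle[OF w_mod this] obtain z where
    z_mod: "\<And>j. z (j mod int n) = z j"
    and wz: "\<And>j. w j = \<phi> (j - 1 - int t) * z (j - 1) - \<phi> j * z j"
    and z_keys: "\<And>j m. m \<in> Poly_Mapping.keys (z j) \<Longrightarrow>
       \<exists>i. \<exists>m'\<in>Poly_Mapping.keys (w i). mon {j - int t..j} + m = mon {i - int t..<i} + m'" by metis
  define u where "u i = - z ((int i - 1) * (int t + 1))" for i
  have uz: "- u (nat ((2 * j + 1) mod int n)) = z j" for j
    using n_gt odd_vertex_mod[of j] z_mod[of j] z_mod[of "((2 * j + 1) mod int n - 1) * (int t + 1)"]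
    by (simp add: u_def)
  have z_bound: "z j \<in> keys_in (\<lambda>m. Poly_Mapping.keys m \<subseteq> skew_vars n \<and> k \<le> off_cycle_degree m \<and> mdeg m + 1 \<le> D)" for j
    unfolding keys_in_def
  proof (intro CollectI ballI)
    fix m assume "m \<in> Poly_Mapping.keys (z j)"
    then obtain i m' where m': "m' \<in> Poly_Mapping.keys (w i)" and eq: "mon {j - int t..j} + m = mon {i - int t..<i} + m'"
      using z_keys by blast
    have "m' \<in> Poly_Mapping.keys (v (vertex i))" "off_cycle_degree m' = k"
      using m' by (simp_all add: w_def)
    then have *: "Poly_Mapping.keys m' \<subseteq> skew_vars n" "off_cycle_degree m' = k" "mdeg m' \<le> D"
      using v[OF vertex_less, of i] by (auto simp: keys_in_def)
    have "Poly_Mapping.keys m \<subseteq> skew_vars n"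
      using arg_cong[OF eq, of Poly_Mapping.keys] keys_mon[of "{i - int t..<i}"] *(1) by (auto simp: keys_add_nat)
    moreover have "off_cycle_degree m = k" using arg_cong[OF eq, of off_cycle_degree] *(2) by simp
    \<comment> \<open>The numerator monomials have \<open>t + 1\<close> and \<open>t\<close>
      factors, which accounts for the 1.\<close>
    moreover have "mdeg m + 1 \<le> D" using arg_cong[OF eq, of mdeg] *(3) by (simp add: mdeg_mon)
    ultimately show "Poly_Mapping.keys m \<subseteq> skew_vars n \<and> k \<le> off_cycle_degree m \<and> mdeg m + 1 \<le> D" by simp
  qed
  show thesis
  proof
    show u_bound: "u i \<in> keys_in (\<lambda>m. Poly_Mapping.keys m \<subseteq> skew_vars n \<and> k \<le> off_cycle_degree m \<and> mdeg m + 1 \<le> D)" for i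
      unfolding u_def by (intro keys_in_uminus z_bound)
    fix i assume i: "i < n"
    define j where "j = int i * (int t + 1)"
    have ij: "vertex j = i" unfolding j_def by (rule vertex_surj[OF i])
    have u_order: "u l \<in> order_ge k" for l using u_bound[of l] by (rule keys_in_mono) auto
    have "(\<Sum>l<n. A (vertex j) l * u l) - w j \<in> order_ge (Suc k)"
      using row_leading[where u = u and k = k and j = j] u_order unfolding uz wz[symmetric] by blast
    moreover have "v (vertex j) - w j \<in> order_ge (Suc k)" unfolding w_def by (rule filter_remainder[OF v_order])
    ultimately have "(v (vertex j) - w j) - ((\<Sum>l<n. A (vertex j) l * u l) - w j) \<in> order_ge (Suc k)"
      by (rule keys_in_diff[rotated])
    then show "v i - (\<Sum>l<n. A i l * u l) \<in> order_ge (Suc k)" by (simp add: ij)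
  qed
qed

text \<open>By \<open>row_leading\<close> the leading parts of \<open>u\<close> satisfy the two-term
  relations of \<open>cycle_exact_left\<close>. The bound leaves room for the factor
  \<open>q i\<close> of degree \<open>t\<close>.\<close>

lemma left_step:
  assumes u: "\<And>i. i < n \<Longrightarrow> u i \<in> keys_in (\<lambda>m. Poly_Mapping.keys m \<subseteq> skew_vars n \<and> k \<le> off_cycle_degree m \<and> mdeg m \<le> D)"
    and cycle: "\<And>i. i < n \<Longrightarrow> (\<Sum>l<n. A i l * u l) = 0"
  obtains c where
    "c \<in> keys_in (\<lambda>m. Poly_Mapping.keys m \<subseteq> skew_vars n \<and> k \<le> off_cycle_degree m \<and> mdeg m + t \<le> D)"
    "\<And>i. i < n \<Longrightarrow> u i - q i * c \<in> order_ge (Suc k)"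
proof -
  define z where "z j = - leading k (u (nat ((2 * j + 1) mod int n)))" for j
  have u_order: "u i \<in> order_ge k" if "i < n" for i
    using u[OF that] by (rule keys_in_mono) auto
  have z_pure: "z j \<in> pure k" for j unfolding z_def by (intro keys_in_uminus leading_pure)
  have z_mod: "z (j mod int n) = z j" for j
  proof -
    have "(2 * (j mod int n) + 1) mod int n = (2 * j + 1) mod int n"
      by (metis mod_add_left_eq mod_mult_right_eq)
    then show ?thesis by (simp add: z_def)
  qed
  have "\<phi> (j - 1 - int t) * z (j - 1) - \<phi> j * z j = 0" for j
  proof (rule pure_order_ge_Suc)
    show "\<phi> (j - 1 - int t) * z (j - 1) - \<phi> j * z j \<in> pure k"
      using pure_mult[OF \<phi>_pure z_pure] by (intro keys_in_diff) simp_all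
    have "(\<Sum>l<n. A (vertex j) l * leading k (u l)) - (\<phi> (j - 1 - int t) * z (j - 1) - \<phi> j * z j) \<in> order_ge (Suc k)"
      unfolding z_def by (rule row_leading) (rule pure_imp_order_ge[OF leading_pure])
    moreover have "(\<Sum>l<n. A (vertex j) l * (u l - leading k (u l))) \<in> order_ge (Suc k)"
      by (intro keys_in_sum order_ge_mult_left filter_remainder u_order) simp
    ultimately have "- (((\<Sum>l<n. A (vertex j) l * leading k (u l)) - (\<phi> (j - 1 - int t) * z (j - 1) - \<phi> j * z j))
        + (\<Sum>l<n. A (vertex j) l * (u l - leading k (u l)))) \<in> order_ge (Suc k)"
      by (intro keys_in_uminus keys_in_add)
    then show "\<phi> (j - 1 - int t) * z (j - 1) - \<phi> j * z j \<in> order_ge (Suc k)"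
      using cycle[OF vertex_less, of j] by (simp add: right_diff_distrib sum_subtractf)
  qed
  then have "\<phi> (j - 1 - int t) * z (j - 1) = \<phi> j * z j" for j by simp
  from cycle_exact_left[OF z_mod this] obtain c where zc: "\<And>j. z j = \<omega> (j + int t + 1) * c"
    and c_keys: "\<And>m. m \<in> Poly_Mapping.keys c \<Longrightarrow> mon {1..<int t + 1} + m \<in> Poly_Mapping.keys (z 0)" by metis
  have c_bound: "c \<in> keys_in (\<lambda>m. Poly_Mapping.keys m \<subseteq> skew_vars n \<and> k \<le> off_cycle_degree m \<and> mdeg m + t \<le> D)"
    unfolding keys_in_def
  proof (intro CollectI ballI)
    fix m assume "m \<in> Poly_Mapping.keys c"
    then have M: "mon {1..<int t + 1} + m \<in> Poly_Mapping.keys (z 0)" by (rule c_keys)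
    have "nat (1 mod int n) < n" using n_gt by (simp add: nat_less_iff)
    moreover have "mon {1..<int t + 1} + m \<in> Poly_Mapping.keys (u (nat (1 mod int n)))"
      "off_cycle_degree (mon {1..<int t + 1} + m) = k"
      using M by (auto simp: z_def in_keys_iff split: if_splits)
    ultimately have "Poly_Mapping.keys (mon {1..<int t + 1} + m) \<subseteq> skew_vars n"
      "mdeg (mon {1..<int t + 1} + m) \<le> D" "off_cycle_degree m = k"
      using u[of "nat (1 mod int n)"] by (auto simp: keys_in_def)
    then show "Poly_Mapping.keys m \<subseteq> skew_vars n \<and> k \<le> off_cycle_degree m \<and> mdeg m + t \<le> D"
      by (simp add: keys_add_nat mdeg_mon)
  qed
  show thesis
  \<comment> \<open>The sign undoes the one in the definition of \<open>z\<close>.\<close>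
  proof (rule that[of "- c"])
    show "- c \<in> keys_in (\<lambda>m. Poly_Mapping.keys m \<subseteq> skew_vars n \<and> k \<le> off_cycle_degree m \<and> mdeg m + t \<le> D)"
      by (rule keys_in_uminus[OF c_bound])
    fix i assume i: "i < n"
    define j where "j = (int i - 1) * (int t + 1)"
    have "2 * j + 1 = int i + int n * (int i - 1)" by (simp add: j_def n_def algebra_simps)
    then have ji: "nat ((2 * j + 1) mod int n) = i" using i by simp
    have "2 * (j + int t + 1) = (2 * j + 1) + int n" by (simp add: n_def)
    then have "2 * (j + int t + 1) mod int n = (2 * j + 1) mod int n" by (metis mod_add_self2)
    then have vi: "vertex (j + int t + 1) = i" using ji by (simp only: vertex_def)
    have "leading k (u i) = - (\<omega> (j + int t + 1) * c)"
      using zc[of j] unfolding z_def ji by (metis minus_minus)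
    then have eq: "u i - q i * (- c) = (u i - leading k (u i)) + (q i - \<omega> (j + int t + 1)) * c"
      by (simp add: algebra_simps)
    have "u i - leading k (u i) \<in> order_ge (Suc k)" by (rule filter_remainder[OF u_order[OF i]])
    moreover have "c \<in> order_ge k" using c_bound by (rule keys_in_mono) auto
    then have "(q i - \<omega> (j + int t + 1)) * c \<in> order_ge (1 + k)"
      using q_leading[of "j + int t + 1"] unfolding vi by (intro order_ge_mult)
    ultimately show "u i - q i * (- c) \<in> order_ge (Suc k)" unfolding eq by (simp add: keys_in_add)
  qed
qed

lemma keys_in_degree_contradiction:
  assumes "p \<in> keys_in (\<lambda>m. Poly_Mapping.keys m \<subseteq> skew_vars n \<and> k \<le> off_cycle_degree m \<and> mdeg m \<le> D)" "D < k"
  shows "p = 0"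
proof -
  have "m \<notin> Poly_Mapping.keys p" for m
    using assms off_cycle_degree_le[of m] by (auto simp: keys_in_def)
  then have "Poly_Mapping.keys p = {}" by blast
  then show ?thesis by simp
qed

text \<open>The induction runs over the orders from \<open>k\<close> to \<open>D\<close> still to be
  cleared. A corrected vector is again a cycle because \<open>q\<close> times the matrix vanishes,
  and the preimages add up.\<close>

lemma exact_middle_bounded:
  assumes "\<And>i. i < n \<Longrightarrow> v i \<in> keys_in (\<lambda>m. Poly_Mapping.keys m \<subseteq> skew_vars n \<and> k \<le> off_cycle_degree m \<and> mdeg m \<le> D)"
    and "(\<Sum>i<n. q i * v i) = 0"
  shows "\<exists>u. (\<forall>i. u i \<in> carrier_polys) \<and> (\<forall>i<n. v i = (\<Sum>l<n. A i l * u l))"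
  using assms
proof (induction "Suc D - k" arbitrary: k v)
  case 0
  then have "v i = 0" if "i < n" for i using keys_in_degree_contradiction[OF 0(2)[OF that]] by simp
  then show ?case by (intro exI[of _ "\<lambda>_. 0"]) simp
next
  case (Suc d)
  obtain u where u: "\<And>i. u i \<in> keys_in (\<lambda>m. Poly_Mapping.keys m \<subseteq> skew_vars n \<and> k \<le> off_cycle_degree m \<and> mdeg m + 1 \<le> D)"
    and vu: "\<And>i. i < n \<Longrightarrow> v i - (\<Sum>l<n. A i l * u l) \<in> order_ge (Suc k)"
    by (rule middle_step[OF Suc.prems]) blast+
  define v' where "v' i = v i - (\<Sum>l<n. A i l * u l)" for i
  have "\<exists>u'. (\<forall>i. u' i \<in> carrier_polys) \<and> (\<forall>i<n. v' i = (\<Sum>l<n. A i l * u' l))"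
  proof (rule Suc.hyps(1))
    show "d = Suc D - Suc k" using Suc.hyps(2) by simp
    fix i assume i: "i < n"
    have "(\<Sum>l<n. A i l * u l) \<in> keys_in (\<lambda>m. Poly_Mapping.keys m \<subseteq> skew_vars n \<and> mdeg m \<le> D)"
    proof (rule keys_in_sum)
      fix l assume "l \<in> {..<n}"
      then have "A i l \<in> forms 1" using i by (intro A_form) auto
      from this u[of l] show "A i l * u l \<in> keys_in (\<lambda>m. Poly_Mapping.keys m \<subseteq> skew_vars n \<and> mdeg m \<le> D)"
        by (rule keys_in_mult) (auto simp: keys_add_nat)
    qed
    moreover have "v i \<in> keys_in (\<lambda>m. Poly_Mapping.keys m \<subseteq> skew_vars n \<and> mdeg m \<le> D)"
      using Suc.prems(1)[OF i] by (rule keys_in_mono) auto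
    ultimately have "v' i \<in> keys_in (\<lambda>m. Poly_Mapping.keys m \<subseteq> skew_vars n \<and> mdeg m \<le> D)"
      unfolding v'_def by (intro keys_in_diff)
    with vu[OF i] show "v' i \<in> keys_in (\<lambda>m. Poly_Mapping.keys m \<subseteq> skew_vars n \<and> Suc k \<le> off_cycle_degree m \<and> mdeg m \<le> D)"
      unfolding v'_def by (auto simp: keys_in_def)
  next
    have "(\<Sum>i<n. q i * (\<Sum>l<n. A i l * u l)) = (\<Sum>l<n. (\<Sum>i<n. q i * A i l) * u l)"
      unfolding sum_distrib_left sum_distrib_right by (subst sum.swap) (simp add: mult.assoc)
    also have "\<dots> = 0" by (simp add: column_relation)
    finally show "(\<Sum>i<n. q i * v' i) = 0"
      using Suc.prems(2) by (simp add: v'_def right_diff_distrib sum_subtractf)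
  qed
  then obtain u' where u': "\<And>i. u' i \<in> carrier_polys" "\<And>i. i < n \<Longrightarrow> v' i = (\<Sum>l<n. A i l * u' l)" by blast
  show ?case
  proof (intro exI[of _ "\<lambda>i. u i + u' i"] conjI allI impI)
    have "u i \<in> carrier_polys" for i using u[of i] by (rule keys_in_mono) auto
    then show "u i + u' i \<in> carrier_polys" for i using u'(1) by (intro keys_in_add)
    show "v i = (\<Sum>l<n. A i l * (u l + u' l))" if "i < n" for i
      using u'(2)[OF that] by (simp add: v'_def algebra_simps sum.distrib)
  qed
qed

lemma exact_left_bounded:
  assumes "\<And>i. i < n \<Longrightarrow> u i \<in> keys_in (\<lambda>m. Poly_Mapping.keys m \<subseteq> skew_vars n \<and> k \<le> off_cycle_degree m \<and> mdeg m \<le> D)"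
    and "\<And>i. i < n \<Longrightarrow> (\<Sum>l<n. A i l * u l) = 0"
  shows "\<exists>c\<in>carrier_polys. \<forall>i<n. u i = q i * c"
  using assms
proof (induction "Suc D - k" arbitrary: k u)
  case 0
  then have "u i = 0" if "i < n" for i using keys_in_degree_contradiction[OF 0(2)[OF that]] by simp
  then show ?case by (intro bexI[of _ 0]) simp_all
next
  case (Suc d)
  obtain c where c: "c \<in> keys_in (\<lambda>m. Poly_Mapping.keys m \<subseteq> skew_vars n \<and> k \<le> off_cycle_degree m \<and> mdeg m + t \<le> D)"
    and uc: "\<And>i. i < n \<Longrightarrow> u i - q i * c \<in> order_ge (Suc k)"
    by (rule left_step[OF Suc.prems]) blast+
  define u' where "u' i = u i - q i * c" for i
  have "\<exists>c'\<in>carrier_polys. \<forall>i<n. u' i = q i * c'"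
  proof (rule Suc.hyps(1))
    show "d = Suc D - Suc k" using Suc.hyps(2) by simp
    fix i assume i: "i < n"
    from q_form[OF i] c have "q i * c \<in> keys_in (\<lambda>m. Poly_Mapping.keys m \<subseteq> skew_vars n \<and> mdeg m \<le> D)"
      by (rule keys_in_mult) (auto simp: keys_add_nat)
    moreover have "u i \<in> keys_in (\<lambda>m. Poly_Mapping.keys m \<subseteq> skew_vars n \<and> mdeg m \<le> D)"
      using Suc.prems(1)[OF i] by (rule keys_in_mono) auto
    ultimately have "u' i \<in> keys_in (\<lambda>m. Poly_Mapping.keys m \<subseteq> skew_vars n \<and> mdeg m \<le> D)"
      unfolding u'_def by (intro keys_in_diff)
    with uc[OF i] show "u' i \<in> keys_in (\<lambda>m. Poly_Mapping.keys m \<subseteq> skew_vars n \<and> Suc k \<le> off_cycle_degree m \<and> mdeg m \<le> D)"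
      unfolding u'_def by (auto simp: keys_in_def)
    have "(\<Sum>l<n. A i l * (q l * c)) = (\<Sum>l<n. A i l * q l) * c"
      by (simp add: sum_distrib_right mult.assoc)
    then show "(\<Sum>l<n. A i l * u' l) = 0"
      using Suc.prems(2)[OF i] row_relation[OF i] by (simp add: u'_def right_diff_distrib sum_subtractf)
  qed
  then obtain c' where c': "c' \<in> carrier_polys" "\<And>i. i < n \<Longrightarrow> u' i = q i * c'" by blast
  show ?case
  proof (intro bexI[of _ "c + c'"] allI impI)
    have "c \<in> carrier_polys" using c by (rule keys_in_mono) auto
    then show "c + c' \<in> carrier_polys" using c'(1) by (rule keys_in_add)
    show "u i = q i * (c + c')" if "i < n" for i
      using c'(2)[OF that] by (simp add: u'_def algebra_simps)
  qed
qed

lemma degree_bound: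
  assumes "\<And>i. i < n \<Longrightarrow> v i \<in> carrier_polys"
  obtains D where "\<And>i. i < n \<Longrightarrow>
    v i \<in> keys_in (\<lambda>m. Poly_Mapping.keys m \<subseteq> skew_vars n \<and> 0 \<le> off_cycle_degree m \<and> mdeg m \<le> D)"
proof
  let ?S = "\<Union>i<n. Poly_Mapping.keys (v i)"
  have "mdeg m \<le> sum mdeg ?S" if "m \<in> ?S" for m
    using that by (intro member_le_sum) auto
  then show "v i \<in> keys_in (\<lambda>m. Poly_Mapping.keys m \<subseteq> skew_vars n \<and> 0 \<le> off_cycle_degree m \<and> mdeg m \<le> sum mdeg ?S)"
    if "i < n" for i
    using assms[OF that] that by (auto simp: keys_in_def)
qed

theorem exact_middle:
  assumes "\<And>i. i < n \<Longrightarrow> v i \<in> carrier_polys" and "(\<Sum>i<n. q i * v i) = 0"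
  obtains u where "\<And>i. u i \<in> carrier_polys" "\<And>i. i < n \<Longrightarrow> v i = (\<Sum>l<n. A i l * u l)"
proof -
  obtain D where D: "\<And>i. i < n \<Longrightarrow>
      v i \<in> keys_in (\<lambda>m. Poly_Mapping.keys m \<subseteq> skew_vars n \<and> 0 \<le> off_cycle_degree m \<and> mdeg m \<le> D)"
    by (rule degree_bound[OF assms(1)]) blast+
  show thesis using exact_middle_bounded[OF D assms(2)] that by blast
qed

theorem exact_left:
  assumes "\<And>i. i < n \<Longrightarrow> u i \<in> carrier_polys" and "\<And>i. i < n \<Longrightarrow> (\<Sum>l<n. A i l * u l) = 0"
  obtains c where "c \<in> carrier_polys" "\<And>i. i < n \<Longrightarrow> u i = q i * c"
proof -
  obtain D where D: "\<And>i. i < n \<Longrightarrow>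
      u i \<in> keys_in (\<lambda>m. Poly_Mapping.keys m \<subseteq> skew_vars n \<and> 0 \<le> off_cycle_degree m \<and> mdeg m \<le> D)"
    by (rule degree_bound[OF assms(1)]) blast+
  show thesis using exact_left_bounded[OF D assms(2)] that by blast
qed

text \<open>The lowest-order part of \<open>q 0 * c\<close> is the lowest-order part of
  \<open>c\<close> times the single term \<open>\<omega> 0\<close>, which can be cancelled.\<close>

theorem q_injective:
  assumes "q 0 * c = 0"
  shows "c = 0"
proof (rule ccontr)
  assume "c \<noteq> 0"
  then have "Poly_Mapping.keys c \<noteq> {}" by simp
  then obtain m where m: "m \<in> Poly_Mapping.keys c" and min: "\<And>m'. m' \<in> Poly_Mapping.keys c \<Longrightarrow> off_cycle_degree m \<le> off_cycle_degree m'"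
    using ex_has_least_nat[of "\<lambda>m. m \<in> Poly_Mapping.keys c" _ off_cycle_degree] by blast
  let ?k = "off_cycle_degree m"
  have c: "c \<in> order_ge ?k" using min by (simp add: keys_in_def)
  have "\<omega> 0 * leading ?k c = 0"
  proof (rule pure_order_ge_Suc)
    show "\<omega> 0 * leading ?k c \<in> pure ?k" using pure_mult[OF \<omega>_pure leading_pure] by simp
    have "(q (vertex 0) - \<omega> 0) * c \<in> order_ge (1 + ?k)" by (rule order_ge_mult[OF q_leading c])
    moreover have "\<omega> 0 * (c - leading ?k c) \<in> order_ge (Suc ?k)" by (rule order_ge_mult_left[OF filter_remainder[OF c]])
    ultimately have "- ((q (vertex 0) - \<omega> 0) * c + \<omega> 0 * (c - leading ?k c)) \<in> order_ge (Suc ?k)"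
      by (intro keys_in_uminus keys_in_add) simp_all
    moreover have "vertex 0 = 0" by (simp add: vertex_def)
    ultimately show "\<omega> 0 * leading ?k c \<in> order_ge (Suc ?k)" using assms by (simp add: algebra_simps)
  qed
  then have "leading ?k c = 0" using \<omega>_cancel[of 0 "leading ?k c" 0] by simp
  then have "m \<notin> Poly_Mapping.keys (leading ?k c)" by simp
  with m show False by simp
qed

end

section \<open>Graded modules over polynomial rings\<close>

text \<open>The bridge between algebraic records and type class arithmetic: on such carriers
  \<open>finsum\<close> and \<open>a_inv\<close> are the ordinary sum and negation.\<close>

locale concrete_additive =
  fixes G :: "('b::ab_group_add, 'c) ring_scheme"
  assumes zero_eq: "zero G = 0" and add_eq: "add G = (+)"
    and zero_in: "0 \<in> carrier G"
    and add_in: "\<lbrakk>x \<in> carrier G; y \<in> carrier G\<rbrakk> \<Longrightarrow> x + y \<in> carrier G"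
    and uminus_in: "x \<in> carrier G \<Longrightarrow> - x \<in> carrier G"
begin

lemma abelian_group: "abelian_group G"
proof (rule abelian_groupI)
  show "\<exists>y\<in>carrier G. y \<oplus>\<^bsub>G\<^esub> x = \<zero>\<^bsub>G\<^esub>" if "x \<in> carrier G" for x
    using that by (intro bexI[of _ "- x"]) (auto simp: zero_eq add_eq uminus_in)
qed (auto simp: zero_eq add_eq zero_in add_in add_ac)

lemma finsum_eq_sum:
  assumes "finite S" "\<And>x. x \<in> S \<Longrightarrow> c x \<in> carrier G"
  shows "finsum G c S = sum c S"
proof -
  interpret abelian_group G by (rule abelian_group)
  show ?thesis using assms
    by (induction S rule: finite_induct) (auto simp: zero_eq add_eq Pi_def)
qed

lemma a_inv_eq: "x \<in> carrier G \<Longrightarrow> a_inv G x = - x"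
proof -
  interpret abelian_group G by (rule abelian_group)
  assume "x \<in> carrier G"
  then show ?thesis by (intro minus_equality) (auto simp: zero_eq add_eq uminus_in)
qed

lemma additive_subgroup_of_closed:
  assumes "H \<subseteq> carrier G" "0 \<in> H" "\<And>x y. \<lbrakk>x \<in> H; y \<in> H\<rbrakk> \<Longrightarrow> x + y \<in> H" "\<And>x. x \<in> H \<Longrightarrow> - x \<in> H"
  shows "additive_subgroup H G"
proof (rule additive_subgroup.intro, rule subgroup.intro)
  show "inv\<^bsub>add_monoid G\<^esub> x \<in> H" if "x \<in> H" for x
    using that assms a_inv_eq[of x] unfolding a_inv_def by auto
qed (use assms in \<open>auto simp: zero_eq add_eq\<close>)

end

abbreviation component :: "int \<Rightarrow> ('v, 'k::field) mpoly \<Rightarrow> ('v, 'k) mpoly" where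
  "component d \<equiv> poly_filter (\<lambda>m. int (mdeg m) = d)"

text \<open>Stated for any carrier closed under components, to cover the ring as well as the ideal.
  Uniqueness holds because the coefficient at \<open>m\<close> can only come from the summand of
  degree \<open>mdeg m\<close>.\<close>

lemma internal_direct_sum_components:
  fixes G :: "(('v, 'k::field) mpoly, 'c) ring_scheme"
  assumes G: "concrete_additive G"
    and comp: "\<And>d p. p \<in> carrier G \<Longrightarrow> component d p \<in> carrier G"
  shows "internal_direct_sum G (\<lambda>d. carrier G \<inter> keys_in (\<lambda>m. int (mdeg m) = d))"
proof -
  interpret concrete_additive G by (rule G)
  let ?P = "\<lambda>d. carrier G \<inter> keys_in (\<lambda>m. int (mdeg m) = d)"
  show ?thesis unfolding internal_direct_sum_def
  proof (intro conjI allI ballI)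
    show "additive_subgroup (?P d) G" for d
      by (rule additive_subgroup_of_closed) (auto simp: zero_in intro: add_in uminus_in keys_in_add keys_in_uminus)
  next
    fix p assume p: "p \<in> carrier G"
    let ?S = "\<lambda>c. {d. c d \<noteq> (0 :: ('v, 'k) mpoly)}"
    have S_subset: "?S (\<lambda>d. component d p) \<subseteq> (\<lambda>m. int (mdeg m)) ` Poly_Mapping.keys p"
    proof
      fix d assume "d \<in> ?S (\<lambda>d. component d p)"
      then have "Poly_Mapping.keys (component d p) \<noteq> {}" by (simp del: keys_poly_filter)
      then show "d \<in> (\<lambda>m. int (mdeg m)) ` Poly_Mapping.keys p" by auto
    qed
    then have fin: "finite (?S (\<lambda>d. component d p))" by (rule finite_subset) simp
    have sum: "p = (\<Sum>d\<in>?S (\<lambda>d. component d p). component d p)"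
    proof (rule poly_mapping_eqI)
      fix m
      have "(\<Sum>d\<in>?S (\<lambda>d. component d p). Poly_Mapping.lookup (component d p) m)
          = (\<Sum>d\<in>{int (mdeg m)}. Poly_Mapping.lookup (component d p) m)"
      proof (rule sum.mono_neutral_cong[OF _ fin])
        fix d assume "d \<in> {int (mdeg m)} - ?S (\<lambda>d. component d p)"
        then have "component d p = 0" by blast
        then show "Poly_Mapping.lookup (component d p) m = 0" by (simp only: lookup_zero)
      qed auto
      then show "Poly_Mapping.lookup p m = Poly_Mapping.lookup (\<Sum>d\<in>?S (\<lambda>d. component d p). component d p) m"
        by (simp add: lookup_sum del: lookup_poly_filter) simp
    qed
    show "\<exists>!c. (\<forall>d. c d \<in> ?P d) \<and> finite {d. c d \<noteq> \<zero>\<^bsub>G\<^esub>} \<and> p = finsum G c {d. c d \<noteq> \<zero>\<^bsub>G\<^esub>}"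
      unfolding zero_eq
    proof (rule ex1I[of _ "\<lambda>d. component d p"])
      have "finsum G (\<lambda>d. component d p) (?S (\<lambda>d. component d p)) = p"
        using sum fin by (subst finsum_eq_sum) (auto simp: comp[OF p])
      then show "(\<forall>d. component d p \<in> ?P d) \<and> finite (?S (\<lambda>d. component d p))
          \<and> p = finsum G (\<lambda>d. component d p) (?S (\<lambda>d. component d p))"
        using fin comp[OF p] by (simp add: keys_in_def)
    next
      fix c assume c: "(\<forall>d. c d \<in> ?P d) \<and> finite (?S c) \<and> p = finsum G c (?S c)"
      then have p_sum: "p = (\<Sum>d\<in>?S c. c d)" by (auto simp: finsum_eq_sum)
      show "c = (\<lambda>d. component d p)"
      proof (intro ext poly_mapping_eqI)
        fix d m
        have other: "Poly_Mapping.lookup (c e) m = 0" if "int (mdeg m) \<noteq> e" for e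
        proof -
          have "m \<notin> Poly_Mapping.keys (c e)" using c that by (auto simp: keys_in_def)
          then show ?thesis by (simp add: in_keys_iff)
        qed
        have "Poly_Mapping.lookup p m = (\<Sum>e\<in>?S c. Poly_Mapping.lookup (c e) m)"
          by (subst p_sum) (simp add: lookup_sum)
        also have "\<dots> = (\<Sum>e\<in>{int (mdeg m)}. Poly_Mapping.lookup (c e) m)"
          by (rule sum.mono_neutral_cong) (use c other in auto)
        finally have "Poly_Mapping.lookup p m = Poly_Mapping.lookup (c (int (mdeg m))) m" by simp
        then show "Poly_Mapping.lookup (c d) m = Poly_Mapping.lookup (component d p) m"
          using other[of d] by auto
      qed
    qed
  qed
qed

lemma poly_ring_simps [simp]:
  "carrier (poly_ring V) = polys_over V"
  "zero (poly_ring V) = 0" "add (poly_ring V) = (+)"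
  "one (poly_ring V) = 1" "monoid.mult (poly_ring V) = (*)"
  by (simp_all add: poly_ring_def keys_in_def)

lemma ring_part_poly_ring:
  "ring_part (poly_ring V) d = polys_over V \<inter> keys_in (\<lambda>m. int (mdeg m) = d)"
  by (auto simp: poly_ring_def keys_in_def)

lemma ring_part_iff:
  "p \<in> ring_part (poly_ring V) d \<longleftrightarrow> p \<in> keys_in (\<lambda>m. Poly_Mapping.keys m \<subseteq> V \<and> int (mdeg m) = d)"
  by (auto simp: poly_ring_def keys_in_def)

lemma ring_part_mult:
  "\<lbrakk>p \<in> ring_part (poly_ring V) d; q \<in> ring_part (poly_ring V) e\<rbrakk> \<Longrightarrow> p * q \<in> ring_part (poly_ring V) (d + e)"
  unfolding ring_part_iff by (erule (1) keys_in_mult) (auto simp: keys_add_nat)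

lemma ring_part_sum:
  "(\<And>x. x \<in> S \<Longrightarrow> f x \<in> ring_part (poly_ring V) d) \<Longrightarrow> (\<Sum>x\<in>S. f x) \<in> ring_part (poly_ring V) d"
  unfolding ring_part_iff by (rule keys_in_sum)

lemma ring_part_subset: "ring_part (poly_ring V) d \<subseteq> polys_over V"
  by (simp add: ring_part_poly_ring)

lemma concrete_additive_poly_ring: "concrete_additive (poly_ring V :: ('v, 'k::field) mpoly graded_ring)"
  by unfold_locales (auto intro: keys_in_add keys_in_uminus)

lemma cring_poly_ring: "cring (poly_ring V :: ('v, 'k::field) mpoly graded_ring)"
proof (rule cringI)
  show "abelian_group (poly_ring V :: ('v, 'k) mpoly graded_ring)"
    by (rule concrete_additive.abelian_group[OF concrete_additive_poly_ring])
  show "comm_monoid (poly_ring V :: ('v, 'k) mpoly graded_ring)"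
    by (rule comm_monoidI) (auto simp: polys_over_mult keys_in_1 mult_ac)
qed (simp add: ring_distribs)

lemma graded_ring_poly_ring: "graded_ring (poly_ring V :: ('v, 'k::field) mpoly graded_ring)"
proof (rule graded_ring.intro[OF cring_poly_ring], unfold_locales)
  show "internal_direct_sum (poly_ring V :: ('v, 'k) mpoly graded_ring) (ring_part (poly_ring V))"
  proof -
    have "internal_direct_sum (poly_ring V :: ('v, 'k) mpoly graded_ring)
        (\<lambda>d. carrier (poly_ring V) \<inter> keys_in (\<lambda>m. int (mdeg m) = d))"
      by (rule internal_direct_sum_components[OF concrete_additive_poly_ring]) (auto simp: keys_in_def)
    then show ?thesis by (simp add: ring_part_poly_ring[abs_def])
  qed
  show "a \<otimes>\<^bsub>poly_ring V\<^esub> b \<in> ring_part (poly_ring V) (d + e)"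
    if "a \<in> ring_part (poly_ring V) d" "b \<in> ring_part (poly_ring V) e" for a b :: "('v, 'k) mpoly" and d e
    using that by (simp add: ring_part_mult)
qed

lemma graded_module_ideal:
  fixes V :: "'v set" and I :: "('v, 'k::field) mpoly set"
  assumes I: "ideal I (poly_ring V)" and comp: "\<And>d p. p \<in> I \<Longrightarrow> component d p \<in> I"
  shows "graded_module (poly_ring V) (ideal_module (poly_ring V) I)"
proof -
  let ?R = "poly_ring V :: ('v, 'k) mpoly graded_ring" and ?M = "ideal_module (poly_ring V) I"
  interpret ideal I ?R by (rule I)
  have sub: "I \<subseteq> polys_over V" using a_subset by simp
  have "- 1 \<in> carrier ?R" by (simp add: keys_in_uminus keys_in_1)
  then have uminus: "- x \<in> I" if "x \<in> I" for x
    using I_l_closed[OF that, of "- 1"] by simp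
  have M: "concrete_additive ?M"
    by unfold_locales
      (use additive_subgroup.zero_closed[OF is_additive_subgroup] additive_subgroup.a_closed[OF is_additive_subgroup]
        uminus in \<open>auto simp: ideal_module_def\<close>)
  have "Module.module ?R ?M"
  proof (rule moduleI[OF cring_poly_ring concrete_additive.abelian_group[OF M]])
    show "a \<odot>\<^bsub>?M\<^esub> x \<in> carrier ?M" if "a \<in> carrier ?R" "x \<in> carrier ?M" for a x
      using that I_l_closed by (simp add: ideal_module_def)
  qed (auto simp: ideal_module_def ring_distribs mult.assoc)
  moreover have "internal_direct_sum ?M (module_part ?M)"
  proof -
    have "module_part ?M = (\<lambda>d. carrier ?M \<inter> keys_in (\<lambda>m. int (mdeg m) = d))"
      using sub by (auto simp: ideal_module_def ring_part_poly_ring fun_eq_iff)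
    then show ?thesis
      using internal_direct_sum_components[OF M] comp by (simp add: ideal_module_def)
  qed
  moreover have "a \<odot>\<^bsub>?M\<^esub> x \<in> module_part ?M (d + e)"
    if "a \<in> ring_part ?R d" "x \<in> module_part ?M e" for a x d e
  proof -
    have "a \<in> carrier ?R" using that(1) ring_part_subset by auto
    then show ?thesis using that I_l_closed[of x a] by (simp add: ideal_module_def ring_part_mult)
  qed
  ultimately show ?thesis
    using graded_ring_poly_ring by (intro graded_module.intro graded_module_axioms.intro) auto
qed

section \<open>Graded free modules and maps given by matrices\<close>

lemma graded_free_poly_ring [simp]:
  "carrier (graded_free (poly_ring V) as) = {..<length as} \<rightarrow>\<^sub>E polys_over V"
  "zero (graded_free (poly_ring V) as) = (\<lambda>i\<in>{..<length as}. 0)"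
  "add (graded_free (poly_ring V) as) = (\<lambda>u v. \<lambda>i\<in>{..<length as}. u i + v i)"
  "smult (graded_free (poly_ring V) as) = (\<lambda>c u. \<lambda>i\<in>{..<length as}. c * u i)"
  "module_part (graded_free (poly_ring V) as) d = (\<Pi>\<^sub>E i\<in>{..<length as}. ring_part (poly_ring V) (d - as ! i))"
  by (simp_all add: graded_free_def)

definition matrix_map :: "nat \<Rightarrow> nat \<Rightarrow> (nat \<Rightarrow> nat \<Rightarrow> 'a) \<Rightarrow> (nat \<Rightarrow> 'a) \<Rightarrow> nat \<Rightarrow> 'a::comm_ring_1" where
  "matrix_map r s B u = (\<lambda>i\<in>{..<r}. \<Sum>l<s. B i l * u l)"

lemma matrix_map_graded_hom:
  fixes B :: "nat \<Rightarrow> nat \<Rightarrow> ('v, 'k::field) mpoly"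
  assumes B: "\<And>i l. \<lbrakk>i < length as; l < length bs\<rbrakk> \<Longrightarrow> B i l \<in> ring_part (poly_ring V) (bs ! l - as ! i)"
  shows "matrix_map (length as) (length bs) B
    \<in> graded_hom (poly_ring V) (graded_free (poly_ring V) bs) (graded_free (poly_ring V) as)"
    (is "?f \<in> graded_hom ?R ?F ?G")
proof -
  have carrier: "?f u \<in> carrier ?G" if "u \<in> carrier ?F" for u
  proof -
    have "(\<Sum>l<length bs. B i l * u l) \<in> polys_over V" if "i < length as" for i
    proof (rule keys_in_sum)
      fix l assume "l \<in> {..<length bs}"
      then have "B i l \<in> polys_over V" "u l \<in> polys_over V"
        using B[OF that, of l] ring_part_subset \<open>u \<in> carrier ?F\<close> by (auto simp: PiE_def Pi_def)
      then show "B i l * u l \<in> polys_over V" by (rule polys_over_mult)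
    qed
    then show ?thesis by (auto simp: matrix_map_def)
  qed
  have part: "?f u \<in> module_part ?G d" if u: "u \<in> module_part ?F d" for u d
  proof -
    have "(\<Sum>l<length bs. B i l * u l) \<in> ring_part ?R (d - as ! i)" if "i < length as" for i
    proof (rule ring_part_sum)
      fix l assume "l \<in> {..<length bs}"
      then have "B i l * u l \<in> ring_part ?R ((bs ! l - as ! i) + (d - bs ! l))"
        using B[OF that, of l] u by (intro ring_part_mult) (auto simp: PiE_def Pi_def)
      then show "B i l * u l \<in> ring_part ?R (d - as ! i)" by simp
    qed
    then show ?thesis by (auto simp: matrix_map_def)
  qed
  show ?thesis
    unfolding graded_hom_def hom_def
  proof (intro CollectI conjI ballI allI)
    show "?f \<in> carrier (add_monoid ?F) \<rightarrow> carrier (add_monoid ?G)" using carrier by auto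
    show "?f (x \<otimes>\<^bsub>add_monoid ?F\<^esub> y) = ?f x \<otimes>\<^bsub>add_monoid ?G\<^esub> ?f y" for x y
      by (rule ext) (simp add: matrix_map_def ring_distribs sum.distrib)
    show "?f (a \<odot>\<^bsub>?F\<^esub> x) = a \<odot>\<^bsub>?G\<^esub> ?f x" for a x
      by (rule ext) (simp add: matrix_map_def sum_distrib_left mult.left_commute)
    show "?f ` module_part ?F d \<subseteq> module_part ?G d" for d using part by blast
  qed
qed

text \<open>Entries of positive degree lie in the irrelevant ideal. The image of \<open>u\<close> is
  the sum, over all matrix positions, of an entry times a vector with the single component
  \<open>u l\<close>; the partial sums \<open>w T\<close> stay in every submodule \<open>N\<close>
  that contains these products.\<close>

lemma matrix_map_minimal:
  fixes B :: "nat \<Rightarrow> nat \<Rightarrow> ('v, 'k::field) mpoly"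
  assumes B: "\<And>i l. \<lbrakk>i < length as; l < length bs\<rbrakk> \<Longrightarrow> B i l \<in> ring_part (poly_ring V) (bs ! l - as ! i)"
    and pos: "\<And>i l. \<lbrakk>i < length as; l < length bs\<rbrakk> \<Longrightarrow> as ! i < bs ! l"
  shows "matrix_map (length as) (length bs) B ` carrier (graded_free (poly_ring V) bs)
    \<subseteq> ideal_times (poly_ring V) (irrelevant_ideal (poly_ring V)) (graded_free (poly_ring V) as)"
proof (clarify, unfold ideal_times_def, intro InterI, clarify)
  let ?R = "poly_ring V :: ('v, 'k) mpoly graded_ring" and ?G = "graded_free (poly_ring V) as :: (('v, 'k) mpoly, nat \<Rightarrow> ('v, 'k) mpoly) graded_module"
  fix u N
  assume u: "u \<in> carrier (graded_free ?R bs)" and N: "submodule N ?R ?G"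
    and prod: "\<forall>a\<in>irrelevant_ideal ?R. \<forall>x\<in>carrier ?G. a \<odot>\<^bsub>?G\<^esub> x \<in> N"
  interpret submodule N ?R ?G by (rule N)
  interpret R: cring ?R by (rule cring_poly_ring)
  have B_irrelevant: "B i l \<in> irrelevant_ideal ?R" if "i < length as" "l < length bs" for i l
  proof -
    have "B i l \<in> (\<Union>d\<in>{0<..}. ring_part ?R d)" using B[OF that] pos[OF that] by auto
    moreover have "(\<Union>d\<in>{0<..}. ring_part ?R d) \<subseteq> carrier ?R" using ring_part_subset by fastforce
    ultimately show ?thesis unfolding irrelevant_ideal_def using R.genideal_self by blast
  qed
  have add_closed: "x \<oplus>\<^bsub>?G\<^esub> y \<in> N" if "x \<in> N" "y \<in> N" for x y
    using m_closed[OF that] by simp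
  define w where "w T = (\<lambda>r\<in>{..<length as}. \<Sum>(i, l)\<in>T. if r = i then B i l * u l else 0)" for T
  have w_in: "w T \<in> N" if "finite T" "T \<subseteq> {..<length as} \<times> {..<length bs}" for T
    using that
  proof (induction T rule: finite_induct)
    case empty
    then show ?case using one_closed by (simp add: w_def restrict_def)
  next
    case (insert p T)
    obtain i l where p: "p = (i, l)" by fastforce
    have il: "i < length as" "l < length bs" using insert.prems p by auto
    define x where "x = (\<lambda>r\<in>{..<length as}. if r = i then u l else 0)"
    have "x \<in> carrier ?G" using u il by (auto simp: x_def PiE_def Pi_def)
    then have "B i l \<odot>\<^bsub>?G\<^esub> x \<in> N" using prod B_irrelevant[OF il] by blast
    moreover have "w T \<in> N" using insert by blast
    ultimately have "(B i l \<odot>\<^bsub>?G\<^esub> x) \<oplus>\<^bsub>?G\<^esub> w T \<in> N" by (rule add_closed)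
    also have "(B i l \<odot>\<^bsub>?G\<^esub> x) \<oplus>\<^bsub>?G\<^esub> w T = w (insert p T)"
      by (rule ext) (use insert.hyps in \<open>simp add: p x_def w_def\<close>)
    finally show ?case .
  qed
  have "(\<Sum>(i, l)\<in>{..<length as} \<times> {..<length bs}. if r = i then B i l * u l else 0) = (\<Sum>l<length bs. B r l * u l)"
    if "r < length as" for r
  proof -
    have "(\<Sum>(i, l)\<in>{..<length as} \<times> {..<length bs}. if r = i then B i l * u l else 0)
        = (\<Sum>l<length bs. \<Sum>i<length as. if r = i then B i l * u l else 0)"
      by (subst sum.cartesian_product[symmetric]) (rule sum.swap)
    then show ?thesis using that by simp
  qed
  then have "matrix_map (length as) (length bs) B u = w ({..<length as} \<times> {..<length bs})"
    unfolding matrix_map_def w_def by (intro restrict_ext) simp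
  then show "matrix_map (length as) (length bs) B u \<in> N" using w_in by simp
qed

section \<open>The resolution\<close>

lemma poly_filter_add: "poly_filter P (p + q) = poly_filter P p + poly_filter P q"
  by (rule poly_mapping_eqI) (simp add: lookup_add)

lemma poly_filter_sum: "poly_filter P (\<Sum>x\<in>S. f x) = (\<Sum>x\<in>S. poly_filter P (f x))"
  by (rule poly_mapping_eqI) (simp add: lookup_sum)

lemma poly_filter_id: "p \<in> keys_in P \<Longrightarrow> poly_filter P p = p"
  by (rule poly_mapping_eqI) (auto simp: keys_in_def in_keys_iff)

lemma poly_filter_none: "p \<in> keys_in (\<lambda>m. \<not> P m) \<Longrightarrow> poly_filter P p = 0"
  by (rule poly_mapping_eqI) (auto simp: keys_in_def in_keys_iff)

text \<open>Only the part of \<open>r\<close> in degree \<open>d - e\<close> can contribute to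
  degree \<open>d\<close>; the product with the remainder has no term there.\<close>

lemma component_mult:
  assumes "p \<in> keys_in (\<lambda>m. int (mdeg m) = e)"
  shows "component d (p * r) = p * component (d - e) r"
proof -
  let ?c = "component (d - e) r"
  have "p * ?c \<in> keys_in (\<lambda>m. int (mdeg m) = d)"
    by (rule keys_in_mult[OF assms, where Q = "\<lambda>m. int (mdeg m) = d - e"]) (auto simp: keys_in_def)
  then have "component d (p * ?c) = p * ?c" by (rule poly_filter_id)
  moreover have "p * (r - ?c) \<in> keys_in (\<lambda>m. \<not> int (mdeg m) = d)"
    by (rule keys_in_mult[OF assms, where Q = "\<lambda>m. int (mdeg m) \<noteq> d - e"])
      (auto simp: keys_in_def in_keys_iff lookup_minus)
  then have "component d (p * (r - ?c)) = 0" by (rule poly_filter_none)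
  moreover have "component d (p * r) = component d (p * ?c) + component d (p * (r - ?c))"
    unfolding poly_filter_add[symmetric] by (simp add: algebra_simps)
  ultimately show ?thesis by simp
qed

context generic_skew
begin

abbreviation R :: "(nat \<times> nat, 'k) mpoly graded_ring" where
  "R \<equiv> poly_ring (skew_vars n)"

lemma form_ring_part: "p \<in> forms d \<Longrightarrow> p \<in> ring_part R (int d)"
  unfolding ring_part_iff by (erule keys_in_mono) simp

lemma q_carrier: "i < n \<Longrightarrow> q i \<in> carrier_polys"
  by (rule forms_imp_carrier[OF q_form])

definition combination :: "(nat \<Rightarrow> (nat \<times> nat, 'k) mpoly) \<Rightarrow> (nat \<times> nat, 'k) mpoly" where
  "combination v = (\<Sum>i<n. q i * v i)"

text \<open>As the image of the augmentation this ideal makes surjectivity immediate;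
  \<open>pfaffian_ideal_eq\<close> identifies it with the ideal of pfaffians.\<close>

definition q_ideal :: "(nat \<times> nat, 'k) mpoly set" where
  "q_ideal = combination ` ({..<n} \<rightarrow>\<^sub>E carrier_polys)"

lemma combination_cong: "(\<And>i. i < n \<Longrightarrow> v i = w i) \<Longrightarrow> combination v = combination w"
  by (simp add: combination_def)

lemma combination_in: "(\<And>i. i < n \<Longrightarrow> v i \<in> carrier_polys) \<Longrightarrow> combination v \<in> q_ideal"
  unfolding q_ideal_def
  by (rule image_eqI[of _ _ "restrict v {..<n}"]) (auto intro!: combination_cong)

lemma q_ideal_cases:
  assumes "p \<in> q_ideal"
  obtains v where "\<And>i. i < n \<Longrightarrow> v i \<in> carrier_polys" "p = combination v"
  using assms by (auto simp: q_ideal_def PiE_def Pi_def)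

lemma q_ideal_ideal: "ideal q_ideal R"
proof (rule idealI)
  show "ring R" by (rule cring.axioms(1)[OF cring_poly_ring])
  have sub: "q_ideal \<subseteq> carrier_polys"
    unfolding q_ideal_def combination_def
    by (auto intro!: keys_in_sum polys_over_mult q_carrier simp: PiE_def Pi_def)
  have "additive_subgroup q_ideal R"
  proof (rule concrete_additive.additive_subgroup_of_closed[OF concrete_additive_poly_ring])
    show "q_ideal \<subseteq> carrier R" using sub by simp
    show "0 \<in> q_ideal" using combination_in[of "\<lambda>_. 0"] by (simp add: combination_def)
    show "x + y \<in> q_ideal" if "x \<in> q_ideal" "y \<in> q_ideal" for x y
    proof -
      obtain v w where v: "\<And>i. i < n \<Longrightarrow> v i \<in> carrier_polys" "x = combination v"
        and w: "\<And>i. i < n \<Longrightarrow> w i \<in> carrier_polys" "y = combination w"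
        using \<open>x \<in> q_ideal\<close> \<open>y \<in> q_ideal\<close> by (metis q_ideal_cases)
      have "x + y = combination (\<lambda>i. v i + w i)" using v w by (simp add: combination_def ring_distribs sum.distrib)
      then show ?thesis using v w by (auto intro!: combination_in keys_in_add)
    qed
    show "- x \<in> q_ideal" if "x \<in> q_ideal" for x
    proof -
      obtain v where v: "\<And>i. i < n \<Longrightarrow> v i \<in> carrier_polys" "x = combination v"
        using \<open>x \<in> q_ideal\<close> by (metis q_ideal_cases)
      have "- x = combination (\<lambda>i. - v i)" using v by (simp add: combination_def sum_negf)
      then show ?thesis using v by (auto intro!: combination_in keys_in_uminus)
    qed
  qed
  then show "subgroup q_ideal (add_monoid R)" by (rule additive_subgroup.a_subgroup)
  show "x \<otimes>\<^bsub>R\<^esub> a \<in> q_ideal" if "a \<in> q_ideal" "x \<in> carrier R" for a x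
  proof -
    obtain v where v: "\<And>i. i < n \<Longrightarrow> v i \<in> carrier_polys" "a = combination v"
      using \<open>a \<in> q_ideal\<close> by (metis q_ideal_cases)
    have "x * a = combination (\<lambda>i. x * v i)" using v by (simp add: combination_def sum_distrib_left mult.left_commute)
    then show ?thesis using v that by (auto intro!: combination_in polys_over_mult)
  qed
  then show "a \<otimes>\<^bsub>R\<^esub> x \<in> q_ideal" if "a \<in> q_ideal" "x \<in> carrier R" for a x
    using that by (simp add: mult.commute)
qed

lemma pfaffian_delete:
  "i < n \<Longrightarrow> pfaffian (submatrix (generic_skew_mat n) ({..<n} - {i}) ({..<n} - {i})) = (-1) ^ i * q i"
proof -
  assume "i < n"
  then have "pfaffian (submatrix (generic_skew_mat n) ({..<n} - {i}) ({..<n} - {i})) = pf A (drop_nth i [0..<n])"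
    by (intro pfaffian_submatrix_delete[OF n_def]) (auto simp: generic_skew_mat_def A_def)
  then show ?thesis by (simp add: q_def mult.assoc[symmetric] power_add[symmetric])
qed

text \<open>A set of \<open>2 * t\<close> indices omits exactly one of the \<open>2 * t + 1\<close>,
  so the generators are the \<open>q i\<close> up to sign, and the signs are units.\<close>

lemma pfaffian_ideal_eq: "pfaffian_ideal n t = q_ideal"
proof -
  interpret R: cring R by (rule cring_poly_ring)
  let ?X = "generic_skew_mat n :: (nat \<times> nat, 'k) mpoly mat"
  let ?G = "{pfaffian (submatrix ?X I I) | I. I \<subseteq> {..<n} \<and> card I = 2 * t}"
  have G: "?G = {(-1) ^ i * q i | i. i < n}"
  proof (intro equalityI subsetI)
    fix p assume "p \<in> ?G"
    then obtain I where I: "I \<subseteq> {..<n}" "card I = 2 * t" and p: "p = pfaffian (submatrix ?X I I)" by blast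
    have "finite I" using I(1) finite_subset by blast
    then have "card ({..<n} - I) = 1" using I by (simp add: card_Diff_subset n_def)
    then obtain i where i: "{..<n} - I = {i}" by (meson card_1_singletonE)
    then have "I = {..<n} - {i}" "i < n" using I(1) by auto
    then show "p \<in> {(-1) ^ i * q i | i. i < n}" using p pfaffian_delete by blast
  next
    fix p assume "p \<in> {(-1) ^ i * q i | i. i < n}"
    then obtain i where i: "i < n" "p = (-1) ^ i * q i" by blast
    then have "p = pfaffian (submatrix ?X ({..<n} - {i}) ({..<n} - {i}))"
      using pfaffian_delete by simp
    moreover have "card ({..<n} - {i}) = 2 * t" using i(1) by (simp add: n_def)
    ultimately show "p \<in> ?G" by blast
  qed
  have carrier: "?G \<subseteq> carrier R" unfolding G using q_carrier by (auto intro: minus_one_power_mult_keys_in)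
  have "?G \<subseteq> q_ideal" unfolding G
  proof clarify
    fix i assume i: "i < n"
    have "(-1) ^ i * q i = combination (\<lambda>j. if j = i then (-1) ^ i else 0)"
      using i by (simp add: combination_def if_distrib mult.commute cong: if_cong)
    moreover have "(-1) ^ i * (1 :: (nat \<times> nat, 'k) mpoly) \<in> carrier_polys"
      by (rule minus_one_power_mult_keys_in) (simp add: keys_in_1)
    ultimately show "(-1) ^ i * q i \<in> q_ideal" by (simp add: combination_in)
  qed
  then have "genideal R ?G \<subseteq> q_ideal" by (rule R.genideal_minimal[OF q_ideal_ideal])
  moreover have "q_ideal \<subseteq> genideal R ?G"
  proof
    interpret J: ideal "genideal R ?G" R by (rule R.genideal_ideal[OF carrier])
    have add: "x + y \<in> genideal R ?G" if "x \<in> genideal R ?G" "y \<in> genideal R ?G" for x y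
      using additive_subgroup.a_closed[OF J.is_additive_subgroup that] by simp
    have zero: "0 \<in> genideal R ?G"
      using additive_subgroup.zero_closed[OF J.is_additive_subgroup] by simp
    fix p assume "p \<in> q_ideal"
    then obtain v where v: "\<And>i. i < n \<Longrightarrow> v i \<in> carrier_polys" "p = combination v" by (metis q_ideal_cases)
    have qv: "q i * v i \<in> genideal R ?G" if "i < n" for i
    proof -
      have "(-1) ^ i * q i \<in> ?G" unfolding G using that by blast
      then have "(-1) ^ i * q i \<in> genideal R ?G" using R.genideal_self[OF carrier] by blast
      moreover have "(-1) ^ i * v i \<in> carrier R" using v(1)[OF that] by (simp add: minus_one_power_mult_keys_in)
      ultimately have "((-1) ^ i * v i) * ((-1) ^ i * q i) \<in> genideal R ?G" using J.I_l_closed by fastforce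
      also have "((-1) ^ i * v i) * ((-1) ^ i * q i) = ((-1) ^ i * (-1) ^ i) * (q i * v i)" by (simp only: mult_ac)
      also have "(-1) ^ i * (-1) ^ i = (1 :: (nat \<times> nat, 'k) mpoly)" by (simp add: power_add[symmetric])
      finally show ?thesis by simp
    qed
    have "(\<Sum>i\<in>S. q i * v i) \<in> genideal R ?G" if "finite S" "S \<subseteq> {..<n}" for S
      using that
    proof (induction S rule: finite_induct)
      case empty
      show ?case using zero by (simp only: sum.empty)
    next
      case (insert i S)
      then have "(\<Sum>i\<in>S. q i * v i) \<in> genideal R ?G" "i < n" by auto
      then show ?case unfolding sum.insert[OF insert.hyps] by (intro add qv)
    qed
    then show "p \<in> genideal R ?G" unfolding v(2) combination_def by blast
  qed
  ultimately show ?thesis unfolding pfaffian_ideal_def by blast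
qed

section \<open>The graded module of the pfaffians and its resolution\<close>

abbreviation M :: "((nat \<times> nat, 'k) mpoly, (nat \<times> nat, 'k) mpoly) graded_module" where
  "M \<equiv> ideal_module R q_ideal"

lemma graded_module_M: "graded_module R M"
proof (rule graded_module_ideal[OF q_ideal_ideal])
  fix d p assume "p \<in> q_ideal"
  then obtain v where v: "\<And>i. i < n \<Longrightarrow> v i \<in> carrier_polys" "p = combination v" by (metis q_ideal_cases)
  have "component d (q i * v i) = q i * component (d - int t) (v i)" if "i < n" for i
    by (rule component_mult) (use q_form[OF that] in \<open>auto simp: keys_in_def\<close>)
  then have "component d p = combination (\<lambda>i. component (d - int t) (v i))"
    unfolding v(2) combination_def poly_filter_sum by simp
  then show "component d p \<in> q_ideal" using v(1) by (auto simp: keys_in_def intro!: combination_in)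
qed

text \<open>Continuing with empty lists lets degrees, differentials and exactness be stated
  uniformly for all positions.\<close>

definition shifts :: "nat \<Rightarrow> int list" where
  "shifts i = (if i = 0 then replicate n (int t) else if i = 1 then replicate n (int t + 1)
     else if i = 2 then [2 * int t + 1] else [])"

definition matrix :: "nat \<Rightarrow> nat \<Rightarrow> nat \<Rightarrow> (nat \<times> nat, 'k) mpoly" where
  "matrix i r l = (if i = 0 then A r l else if i = 1 then q r else 0)"

definition differential :: "nat \<Rightarrow> (nat \<Rightarrow> (nat \<times> nat, 'k) mpoly) \<Rightarrow> nat \<Rightarrow> (nat \<times> nat, 'k) mpoly" where
  "differential i = matrix_map (length (shifts i)) (length (shifts (Suc i))) (matrix i)"

lemma free_term_shifts:
  "free_term R [replicate n (int t), replicate n (int t + 1), [2 * int t + 1]] i = graded_free R (shifts i)"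
proof -
  consider "i = 0" | "i = 1" | "i = 2" | "i > 2" by linarith
  then show ?thesis by cases (simp_all add: free_term_def shifts_def)
qed

lemma matrix_degrees:
  assumes "r < length (shifts i)" "l < length (shifts (Suc i))"
  shows "matrix i r l \<in> ring_part R (shifts (Suc i) ! l - shifts i ! r)"
    and "shifts i ! r < shifts (Suc i) ! l"
proof -
  have "i = 0 \<or> i = 1" using assms(2) by (auto simp: shifts_def split: if_splits)
  then show "matrix i r l \<in> ring_part R (shifts (Suc i) ! l - shifts i ! r)"
    using assms form_ring_part[OF A_form, of r l] form_ring_part[OF q_form, of r]
    by (auto simp: shifts_def matrix_def)
  \<comment> \<open>For the column \<open>q\<close> this is \<open>t + 1 < 2 * t + 1\<close>, where
    \<open>t \<ge> 1\<close> enters.\<close>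
  show "shifts i ! r < shifts (Suc i) ! l"
    using \<open>i = 0 \<or> i = 1\<close> assms t_pos by (auto simp: shifts_def)
qed

lemma combination_graded_hom: "combination \<in> graded_hom R (graded_free R (shifts 0)) M"
  unfolding graded_hom_def hom_def
proof (intro CollectI conjI ballI allI)
  let ?F = "graded_free R (shifts 0)"
  show "combination \<in> carrier (add_monoid ?F) \<rightarrow> carrier (add_monoid M)"
    by (auto simp: shifts_def ideal_module_def intro!: combination_in)
  show "combination (x \<otimes>\<^bsub>add_monoid ?F\<^esub> y) = combination x \<otimes>\<^bsub>add_monoid M\<^esub> combination y" for x y
    by (simp add: shifts_def ideal_module_def combination_def ring_distribs sum.distrib)
  show "combination (a \<odot>\<^bsub>?F\<^esub> x) = a \<odot>\<^bsub>M\<^esub> combination x" for a x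
    by (simp add: shifts_def ideal_module_def combination_def sum_distrib_left mult.left_commute)
  fix d
  show "combination ` module_part ?F d \<subseteq> module_part M d"
  proof clarify
    fix v assume v: "v \<in> module_part ?F d"
    then have part: "v i \<in> ring_part R (d - int t)" if "i < n" for i
      using that by (auto simp: shifts_def PiE_def Pi_def)
    have "q i * v i \<in> ring_part R (int t + (d - int t))" if "i < n" for i
      by (rule ring_part_mult[OF form_ring_part[OF q_form] part]) (use that in simp_all)
    then have "combination v \<in> ring_part R d" unfolding combination_def by (intro ring_part_sum) simp
    moreover have "combination v \<in> q_ideal"
      using part ring_part_subset by (intro combination_in) blast
    ultimately show "combination v \<in> module_part M d" by (simp add: ideal_module_def)
  qed
qed

lemma differential_eq:
  "differential 0 u = (\<lambda>i\<in>{..<n}. \<Sum>l<n. A i l * u l)"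
  "differential (Suc 0) u = (\<lambda>i\<in>{..<n}. q i * u 0)"
  "i \<ge> 2 \<Longrightarrow> differential i u = (\<lambda>j\<in>{..<length (shifts i)}. 0)"
  by (simp_all add: differential_def matrix_map_def matrix_def shifts_def cong: restrict_cong)

lemma exact_at_0:
  "differential 0 ` carrier (graded_free R (shifts 1)) = a_kernel (graded_free R (shifts 0)) M combination"
proof (intro equalityI subsetI)
  fix v assume "v \<in> differential 0 ` carrier (graded_free R (shifts 1))"
  then obtain u where u: "\<And>l. l < n \<Longrightarrow> u l \<in> carrier_polys" and v: "v = differential 0 u"
    by (auto simp: shifts_def PiE_def Pi_def)
  have "combination v = (\<Sum>i<n. q i * (\<Sum>l<n. A i l * u l))"
    by (simp add: v differential_eq combination_def)
  also have "\<dots> = (\<Sum>l<n. (\<Sum>i<n. q i * A i l) * u l)"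
    unfolding sum_distrib_left sum_distrib_right by (subst sum.swap) (simp add: mult.assoc)
  also have "\<dots> = 0" by (simp add: column_relation)
  finally have "combination v = 0" .
  moreover have "(\<Sum>l<n. A i l * u l) \<in> carrier_polys" if "i < n" for i
    using u forms_imp_carrier[OF A_form] that by (intro keys_in_sum polys_over_mult) auto
  then have "v \<in> {..<n} \<rightarrow>\<^sub>E carrier_polys" by (auto simp: v differential_eq)
  ultimately show "v \<in> a_kernel (graded_free R (shifts 0)) M combination"
    by (simp add: a_kernel_def' shifts_def ideal_module_def)
next
  fix v assume "v \<in> a_kernel (graded_free R (shifts 0)) M combination"
  then have v: "v \<in> {..<n} \<rightarrow>\<^sub>E carrier_polys" and 0: "(\<Sum>i<n. q i * v i) = 0"
    by (auto simp: a_kernel_def' shifts_def ideal_module_def combination_def)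
  obtain u where u: "\<And>i. u i \<in> carrier_polys" "\<And>i. i < n \<Longrightarrow> v i = (\<Sum>l<n. A i l * u l)"
    by (rule exact_middle[OF _ 0]) (use v in auto)
  have "v = differential 0 (restrict u {..<n})"
  proof
    fix i
    show "v i = differential 0 (restrict u {..<n}) i"
      using v u(2) by (cases "i < n") (auto simp: differential_eq PiE_def extensional_def)
  qed
  then show "v \<in> differential 0 ` carrier (graded_free R (shifts 1))"
    using u(1) by (intro image_eqI[of _ _ "restrict u {..<n}"]) (auto simp: shifts_def)
qed

lemma exact_at_1:
  "differential 1 ` carrier (graded_free R (shifts 2))
    = a_kernel (graded_free R (shifts 1)) (graded_free R (shifts 0)) (differential 0)"
proof (intro equalityI subsetI)
  fix v assume "v \<in> differential 1 ` carrier (graded_free R (shifts 2))"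
  then obtain u where u: "u 0 \<in> carrier_polys" and v: "v = differential 1 u"
    by (auto simp: shifts_def PiE_def Pi_def)
  have "(\<Sum>l<n. A i l * (q l * u 0)) = (\<Sum>l<n. A i l * q l) * u 0" for i
    by (simp add: sum_distrib_right mult.assoc)
  then have "differential 0 v = (\<lambda>i\<in>{..<n}. 0)"
    by (simp add: v differential_eq row_relation cong: restrict_cong)
  moreover have "v \<in> {..<n} \<rightarrow>\<^sub>E carrier_polys"
    using u q_carrier by (auto simp: v differential_eq intro: polys_over_mult)
  ultimately show "v \<in> a_kernel (graded_free R (shifts 1)) (graded_free R (shifts 0)) (differential 0)"
    by (simp add: a_kernel_def' shifts_def)
next
  fix v assume "v \<in> a_kernel (graded_free R (shifts 1)) (graded_free R (shifts 0)) (differential 0)"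
  then have v: "v \<in> {..<n} \<rightarrow>\<^sub>E carrier_polys" and 0: "differential 0 v = (\<lambda>i\<in>{..<n}. 0)"
    by (auto simp: a_kernel_def' shifts_def)
  have "(\<Sum>l<n. A i l * v l) = 0" if "i < n" for i
    using fun_cong[OF 0, of i] that by (simp add: differential_eq)
  then obtain c where c: "c \<in> carrier_polys" "\<And>i. i < n \<Longrightarrow> v i = q i * c"
    by (rule exact_left[rotated]) (use v in auto)
  have "v = differential 1 (\<lambda>i\<in>{..<1}. c)"
  proof
    fix i
    show "v i = differential 1 (\<lambda>i\<in>{..<1}. c) i"
      using v c(2) by (cases "i < n") (auto simp: differential_eq PiE_def extensional_def)
  qed
  then show "v \<in> differential 1 ` carrier (graded_free R (shifts 2))"
    using c(1) by (intro image_eqI[of _ _ "\<lambda>i\<in>{..<1}. c"]) (auto simp: shifts_def)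
qed

text \<open>The term to the left is zero, so this is injectivity of the column \<open>q\<close>,
  which its entry \<open>q 0\<close> already guarantees.\<close>

lemma exact_at_2:
  "differential 2 ` carrier (graded_free R (shifts 3))
    = a_kernel (graded_free R (shifts 2)) (graded_free R (shifts 1)) (differential 1)"
proof -
  let ?z = "\<lambda>i\<in>{..<1}. 0 :: (nat \<times> nat, 'k) mpoly"
  have "v = ?z" if "v \<in> {..<1} \<rightarrow>\<^sub>E carrier_polys" "differential 1 v = (\<lambda>i\<in>{..<n}. 0)" for v
  proof
    fix i
    have "q 0 * v 0 = 0" using fun_cong[OF that(2), of 0] by (simp add: differential_eq n_def)
    then have "v 0 = 0" by (rule q_injective)
    then show "v i = ?z i" using that(1) by (cases "i = 0") (auto simp: PiE_def extensional_def)
  qed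
  moreover have "differential 1 ?z = (\<lambda>i\<in>{..<n}. 0)" by (simp add: differential_eq)
  moreover have "?z \<in> {..<1} \<rightarrow>\<^sub>E carrier_polys" by simp
  ultimately have "{v \<in> {..<1} \<rightarrow>\<^sub>E carrier_polys. differential 1 v = (\<lambda>i\<in>{..<n}. 0)} = {?z}" by blast
  then show ?thesis by (simp add: a_kernel_def' differential_eq shifts_def)
qed

lemma exact_above_2:
  assumes "i \<ge> 2"
  shows "differential (Suc i) ` carrier (graded_free R (shifts (Suc (Suc i))))
    = a_kernel (graded_free R (shifts (Suc i))) (graded_free R (shifts i)) (differential i)"
  using assms by (auto simp: a_kernel_def' differential_eq shifts_def)

theorem minimal_resolution:
  "minimal_graded_free_resolution R M
     [replicate n (int t), replicate n (int t + 1), [2 * int t + 1]] differential combination"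
  unfolding minimal_graded_free_resolution_def graded_free_resolution_def free_term_shifts
proof (intro conjI allI)
  show "graded_module R M" by (rule graded_module_M)
  show "differential i \<in> graded_hom R (graded_free R (shifts (Suc i))) (graded_free R (shifts i))" for i
    unfolding differential_def by (rule matrix_map_graded_hom) (rule matrix_degrees)
  show "combination \<in> graded_hom R (graded_free R (shifts 0)) M" by (rule combination_graded_hom)
  show "combination ` carrier (graded_free R (shifts 0)) = carrier M"
    by (simp add: q_ideal_def shifts_def ideal_module_def)
  show "differential 0 ` carrier (graded_free R (shifts 1)) = a_kernel (graded_free R (shifts 0)) M combination"
    by (rule exact_at_0)
  show "differential (Suc i) ` carrier (graded_free R (shifts (Suc (Suc i))))
    = a_kernel (graded_free R (shifts (Suc i))) (graded_free R (shifts i)) (differential i)" for i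
  proof -
    consider "i = 0" | "i = 1" | "i \<ge> 2" by linarith
    then show ?thesis
      using exact_at_1 exact_at_2 exact_above_2 by cases (simp_all add: numeral_2_eq_2 numeral_3_eq_3)
  qed
  show "differential i ` carrier (graded_free R (shifts (Suc i)))
      \<subseteq> ideal_times R (irrelevant_ideal R) (graded_free R (shifts i))" for i
    unfolding differential_def by (rule matrix_map_minimal) (rule matrix_degrees, assumption+)+
qed

end

theorem proposition4p3:
  fixes t :: nat
    and R :: "(nat \<times> nat, 'k::field) mpoly graded_ring"
    and M :: "((nat \<times> nat, 'k) mpoly, (nat \<times> nat, 'k) mpoly) graded_module"
  assumes "t \<ge> 1"
    and "R = poly_ring (skew_vars (2 * t + 1))"
    and "M = ideal_module R (pfaffian_ideal (2 * t + 1) t)"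
  shows "\<exists>d e. minimal_graded_free_resolution R M
           [replicate (2 * t + 1) (int t),
            replicate (2 * t + 1) (int t + 1),
            [2 * int t + 1]] d e"
proof -
  interpret generic_skew t "\<lambda>i j. if i < j then indet (i, j) else if j < i then - indet (j, i) else 0 :: (nat \<times> nat, 'k) mpoly"
    by unfold_locales (use assms(1) in auto)
  show ?thesis
    using minimal_resolution pfaffian_ideal_eq unfolding assms(2,3) n_def by metis
qed

end
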